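(* Let $n\in\mathbb{N}\cup\{\infty\}$, let $T\in\mathcal{S}_n(\mathcal{H})$, let $\Gamma$ be a model for $T$ with auxiliary Hilbert space $\mathcal{K}$, and let $K_\lambda(z)=\Gamma(z)^*\Gamma(\lambda)$, $\lambda,z\in\mathbb{C}\setminus\mathbb{R}$. Put $$b(z)=\frac{z-i}{z+i},\quad \Phi(z):=K_i(z)K_i(i)^{-1/2},\quad \Psi(z):=K_{-i}(z)K_{-i}(-i)^{-1/2},\quad V(z):=b(z)\Phi(z)^{-1}\Psi(z).$$ Then $$K_\lambda(z)=\Phi(z)\left(\frac{I-V(z)V(\lambda)^*}{1-\overline{b(\lambda)}\,b(z)}\right)\Phi(\lambda)^*$$ for $\lambda,z\in\mathbb{C}\setminus\mathbb{R}$ (understood in the sense of meromorphic functions at points where an individual factor has a pole or the denominator vanishes), and: (1) $z\mapsto\Phi(z)$ is a $\mathcal{B}(\mathcal{K})$-valued meromorphic function on $\mathbb{C}\setminus\mathbb{R}$ which is analytic on $\mathbb{C}_+$; (2) $z\mapsto\Psi(z)$ is a $\mathcal{B}(\mathcal{K})$-valued meromorphic function on $\mathbb{C}\setminus\mathbb{R}$ which is analytic on $\mathbb{C}_-$; (3) $z\mapsto V(z)$ is a $\mathcal{B}(\mathcal{K})$-valued meromorphic function on $\mathbb{C}\setminus\mathbb{R}$ such that $\|V(z)\|<1$ for all $z\in\mathbb{C}_+$.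
   Context: $\mathcal{S}_n(\mathcal{H})$ denotes the set of closed, densely defined linear operators $T:\mathscr{D}(T)\subset\mathcal{H}\to\mathcal{H}$ on a complex separable Hilbert space $\mathcal{H}$ that are symmetric ($\langle Tx,y\rangle=\langle x,Ty\rangle$ for all $x,y\in\mathscr{D}(T)$), simple ($\bigcap_{\Im\lambda\neq0}\mathrm{Rng}(T-\lambda I)=\{0\}$), and have deficiency indices $(n,n)$, i.e. $\dim\mathrm{Rng}(T-iI)^\perp=\dim\mathrm{Rng}(T+iI)^\perp=n$. $\mathbb{C}_\pm$ are the open upper/lower half planes. $\mathcal{K}$ is a complex separable Hilbert space of dimension $n$. A model for $T$ is a map $\Gamma:\mathbb{C}\setminus\mathbb{R}\to\mathcal{B}(\mathcal{K},\mathcal{H})$ such that: (1) $\Gamma$ is co-analytic (analytic in $\overline{\lambda}$); (2) for each $\lambda\in\mathbb{C}\setminus\mathbb{R}$, $\Gamma(\lambda)$ is an invertible map from $\mathcal{K}$ onto $\mathrm{Rng}(T-\lambda I)^\perp$; (3) $\Gamma(z)^*\Gamma(\lambda):\mathcal{K}\to\mathcal{K}$ is invertible whenever $\lambda,z\in\mathbb{C}_+$ or $\lambda,z\in\mathbb{C}_-$; (4) the closed linear span of $\bigcup_{\Im\lambda\ne0}\mathrm{Rng}\,\Gamma(\lambda)$ is $\mathcal{H}$. $K_\lambda(z)$ is the reproducing kernel of the Hilbert space $\mathcal{H}(\Gamma)=\{\widehat f:f\in\mathcal{H}\}$, $\widehat f(\lambda)=\Gamma(\lambda)^*f$, $\langle\widehat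 f,\widehat g\rangle_{\mathcal{H}(\Gamma)}=\langle f,g\rangle_{\mathcal{H}}$.
   Formalization: For n=∞, V is shown meromorphic on C\R only if Φ^{-1} is meromorphic on C_-; without this the claim can fail. Where Φ(z) has no bounded inverse, V(z) is set to 0 and the kernel formula is given by limits or with the poles cancelled. *)

theory Defs
  imports "HOL-Analysis.Analysis" "HOL-Library.Extended_Nat"
begin

section \<open>Complex Hilbert spaces\<close>

text \<open>
  Complex structures are added on top of the real classes of the library, so that the library's
  norms, topology, completeness, bounded operators and Frechet derivatives apply unchanged.
\<close>

class complex_normed_vector = real_normed_vector +
  fixes scaleC :: "complex \<Rightarrow> 'a \<Rightarrow> 'a"  (infixr \<open>*\<^sub>C\<close> 75)
  assumes scaleC_add_right: "a *\<^sub>C (x + y) = a *\<^sub>C x + a *\<^sub>C y"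
    and scaleC_add_left: "(a + b) *\<^sub>C x = a *\<^sub>C x + b *\<^sub>C x"
    and scaleC_scaleC: "a *\<^sub>C (b *\<^sub>C x) = (a * b) *\<^sub>C x"
    and scaleC_of_real: "of_real r *\<^sub>C x = r *\<^sub>R x"
    and norm_scaleC: "norm (a *\<^sub>C x) = cmod a * norm x"

text \<open>The complex inner product is linear in the first and conjugate linear in the second
  argument; its real part is the inner product of the library, which fixes the norm.\<close>

class complex_inner = complex_normed_vector + real_inner +
  fixes cinner :: "'a \<Rightarrow> 'a \<Rightarrow> complex"
  assumes cinner_commute: "cinner x y = cnj (cinner y x)"
    and cinner_add_left: "cinner (x + y) z = cinner x z + cinner y z"
    and cinner_scaleC_left: "cinner (a *\<^sub>C x) y = a * cinner x y"
    and Re_cinner: "Re (cinner x y) = inner x y"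

class complex_hilbert = complex_inner + complete_space

instantiation complex :: complex_hilbert
begin

definition scaleC_complex :: "complex \<Rightarrow> complex \<Rightarrow> complex"
  where "scaleC_complex a x = a * x"

definition cinner_complex :: "complex \<Rightarrow> complex \<Rightarrow> complex"
  where "cinner_complex x y = x * cnj y"

instance
  by standard
    (auto simp: scaleC_complex_def cinner_complex_def algebra_simps norm_mult scaleR_conv_of_real
      inner_complex_def)

end

global_interpretation complex_vector:
  vector_space "scaleC :: complex \<Rightarrow> 'a \<Rightarrow> 'a::complex_normed_vector"
  defines csubspace = complex_vector.subspace
    and cspan = complex_vector.span
proof
  show "1 *\<^sub>C x = x" for x :: 'a
    using scaleC_of_real[of 1 x] by simp
qed (simp_all add: scaleC_add_right scaleC_add_left scaleC_scaleC)

definition corthogonal_comp :: "'a::complex_inner set \<Rightarrow> 'a set"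
  where "corthogonal_comp S = {y. \<forall>x\<in>S. cinner x y = 0}"

definition corthonormal :: "'a::complex_inner set \<Rightarrow> bool"
  where "corthonormal B \<longleftrightarrow> (\<forall>x\<in>B. \<forall>y\<in>B. cinner x y = (if x = y then 1 else 0))"

text \<open>The Hilbert space dimension of a closed subspace M of a separable space, with values
  in the naturals extended by infinity.\<close>

definition has_hilbert_dim :: "'a::complex_inner set \<Rightarrow> enat \<Rightarrow> bool"
  where "has_hilbert_dim M n \<longleftrightarrow>
    (\<exists>B. corthonormal B \<and> closure (cspan B) = M \<and> n = (if finite B then enat (card B) else \<infinity>))"


section \<open>Bounded operators\<close>

text \<open>
  The library type \<^typ>\<open>'a \<Rightarrow>\<^sub>L 'b\<close> consists of the bounded real-linear maps. It is a complex normed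
  space whenever the codomain is one; the bounded complex-linear operators form a closed complex
  subspace of it, with the same operator norm.
\<close>

instantiation blinfun :: (real_normed_vector, complex_normed_vector) complex_normed_vector
begin

lift_definition scaleC_blinfun :: "complex \<Rightarrow> 'a \<Rightarrow>\<^sub>L 'b \<Rightarrow> 'a \<Rightarrow>\<^sub>L 'b"
  is "\<lambda>a f x. a *\<^sub>C f x"
proof -
  fix a :: complex and f :: "'a \<Rightarrow> 'b"
  assume f: "bounded_linear f"
  then obtain K where K: "\<And>x. norm (f x) \<le> norm x * K"
    using bounded_linear.bounded by blast
  show "bounded_linear (\<lambda>x. a *\<^sub>C f x)"
  proof (rule bounded_linear_intro[where K = "cmod a * K"])
    fix x y :: 'a and r :: real
    show "a *\<^sub>C f (x + y) = a *\<^sub>C f x + a *\<^sub>C f y"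
      by (simp add: linear_add[OF bounded_linear.linear[OF f]] scaleC_add_right)
    show "a *\<^sub>C f (r *\<^sub>R x) = r *\<^sub>R (a *\<^sub>C f x)"
      by (simp add: linear_scale[OF bounded_linear.linear[OF f]] mult.commute
          flip: scaleC_of_real)
    show "norm (a *\<^sub>C f x) \<le> norm x * (cmod a * K)"
      using mult_left_mono[OF K[of x], of "cmod a"] by (simp add: norm_scaleC mult_ac)
  qed
qed

instance
proof
  fix a b :: complex and r :: real and A B :: "'a \<Rightarrow>\<^sub>L 'b"
  show "a *\<^sub>C (A + B) = a *\<^sub>C A + a *\<^sub>C B"
    by transfer (simp add: scaleC_add_right)
  show "(a + b) *\<^sub>C A = a *\<^sub>C A + b *\<^sub>C A"
    by transfer (simp add: scaleC_add_left)
  show "a *\<^sub>C (b *\<^sub>C A) = (a * b) *\<^sub>C A"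
    by transfer simp
  show "of_real r *\<^sub>C A = r *\<^sub>R A"
    by transfer (simp add: scaleC_of_real)
  show "norm (a *\<^sub>C A) = cmod a * norm A"
  proof (cases "a = 0")
    case True
    have "(0::complex) *\<^sub>C A = 0"
      by transfer simp
    then show ?thesis using True by simp
  next
    case False
    have le: "norm (c *\<^sub>C C) \<le> cmod c * norm C" for c and C :: "'a \<Rightarrow>\<^sub>L 'b"
    proof (rule norm_blinfun_bound)
      fix x
      show "norm (blinfun_apply (c *\<^sub>C C) x) \<le> cmod c * norm C * norm x"
        using mult_left_mono[OF norm_blinfun[of C x], of "cmod c"]
        by (simp add: scaleC_blinfun.rep_eq norm_scaleC mult.assoc)
    qed simp
    have "inverse a *\<^sub>C (a *\<^sub>C A) = A"
      using False by transfer simp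
    then have "norm A \<le> cmod (inverse a) * norm (a *\<^sub>C A)"
      using le[of "inverse a" "a *\<^sub>C A"] by simp
    then have "cmod a * norm A \<le> norm (a *\<^sub>C A)"
      using False by (simp add: norm_inverse norm_divide field_simps)
    then show ?thesis using le[of a A] by simp
  qed
qed

end

definition bounded_ops :: "('a::complex_normed_vector \<Rightarrow>\<^sub>L 'b::complex_normed_vector) set"
  where "bounded_ops = {A. \<forall>c x. blinfun_apply A (c *\<^sub>C x) = c *\<^sub>C blinfun_apply A x}"

text \<open>For complex-linear operators between complex Hilbert spaces the adjoint exists, is unique
  and is complex-linear.\<close>

definition op_adj :: "('a::complex_hilbert \<Rightarrow>\<^sub>L 'b::complex_hilbert) \<Rightarrow> ('b \<Rightarrow>\<^sub>L 'a)"
  where "op_adj A =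
    (THE B. \<forall>x y. cinner (blinfun_apply A x) y = cinner x (blinfun_apply B y))"

definition op_invertible :: "('a::real_normed_vector \<Rightarrow>\<^sub>L 'a) \<Rightarrow> bool"
  where "op_invertible A \<longleftrightarrow> (\<exists>B. A o\<^sub>L B = id_blinfun \<and> B o\<^sub>L A = id_blinfun)"

text \<open>Set to zero at operators without a bounded inverse, like division by zero. The inverse of a
  complex-linear operator is complex-linear.\<close>

definition op_inverse :: "('a::real_normed_vector \<Rightarrow>\<^sub>L 'a) \<Rightarrow> ('a \<Rightarrow>\<^sub>L 'a)"
  where "op_inverse A =
    (if op_invertible A then (THE B. A o\<^sub>L B = id_blinfun \<and> B o\<^sub>L A = id_blinfun) else 0)"

definition positive_op :: "('a::complex_hilbert \<Rightarrow>\<^sub>L 'a) \<Rightarrow> bool"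
  where "positive_op A \<longleftrightarrow>
    A \<in> bounded_ops \<and> (\<forall>x. cinner (blinfun_apply A x) x \<in> \<real>\<^sub>\<ge>\<^sub>0)"

text \<open>The unique positive square root, for positive operators.\<close>

definition op_sqrt :: "('a::complex_hilbert \<Rightarrow>\<^sub>L 'a) \<Rightarrow> ('a \<Rightarrow>\<^sub>L 'a)"
  where "op_sqrt A = (THE B. positive_op B \<and> B o\<^sub>L B = A)"


section \<open>Analytic and meromorphic vector-valued functions\<close>

text \<open>Complex Frechet differentiability in norm; used on open sets.\<close>

definition vec_holomorphic_on ::
    "(complex \<Rightarrow> 'a::complex_normed_vector) \<Rightarrow> complex set \<Rightarrow> bool"
  where "vec_holomorphic_on f S \<longleftrightarrow>
    (\<forall>z\<in>S. \<exists>D. (f has_derivative (\<lambda>h. h *\<^sub>C D)) (at z within S))"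

lemma vec_holomorphic_on_complex:
  fixes f :: "complex \<Rightarrow> complex"
  shows "vec_holomorphic_on f S \<longleftrightarrow> f holomorphic_on S"
  by (simp add: vec_holomorphic_on_def holomorphic_on_def field_differentiable_def
      has_field_derivative_def scaleC_complex_def mult.commute[of "_::complex"])

text \<open>Analyticity in the conjugate of the variable.\<close>

definition vec_coholomorphic_on ::
    "(complex \<Rightarrow> 'a::complex_normed_vector) \<Rightarrow> complex set \<Rightarrow> bool"
  where "vec_coholomorphic_on f S \<longleftrightarrow> vec_holomorphic_on (\<lambda>z. f (cnj z)) (cnj ` S)"

text \<open>At every point the function has a Laurent expansion with finite principal part. As for
  \<open>meromorphic_on\<close> in the library, the value at an isolated singularity is irrelevant.\<close>

definition vec_meromorphic_on ::
    "(complex \<Rightarrow> 'a::complex_normed_vector) \<Rightarrow> complex set \<Rightarrow> bool"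
  where "vec_meromorphic_on f S \<longleftrightarrow>
    (\<forall>z\<in>S. \<exists>m g r. 0 < r \<and> vec_holomorphic_on g (ball z r) \<and>
      (\<forall>w\<in>ball z r - {z}. (w - z) ^ m *\<^sub>C f w = g w))"


section \<open>Symmetric operators and their models\<close>

abbreviation nonreal :: "complex set"
  where "nonreal \<equiv> {z. Im z \<noteq> 0}"

abbreviation upper_half :: "complex set"
  where "upper_half \<equiv> {z. Im z > 0}"

abbreviation lower_half :: "complex set"
  where "lower_half \<equiv> {z. Im z < 0}"

text \<open>An unbounded operator is given by its domain \<open>D\<close> and a function \<open>T\<close> whose values outside
  \<open>D\<close> are irrelevant.\<close>

definition closed_densely_defined ::
    "'a::complex_normed_vector set \<Rightarrow> ('a \<Rightarrow> 'a) \<Rightarrow> bool"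
  where "closed_densely_defined D T \<longleftrightarrow>
    csubspace D \<and>
    (\<forall>x\<in>D. \<forall>y\<in>D. T (x + y) = T x + T y) \<and>
    (\<forall>c. \<forall>x\<in>D. T (c *\<^sub>C x) = c *\<^sub>C T x) \<and>
    closed ((\<lambda>x. (x, T x)) ` D) \<and>
    closure D = UNIV"

definition rng_shift :: "'a::complex_normed_vector set \<Rightarrow> ('a \<Rightarrow> 'a) \<Rightarrow> complex \<Rightarrow> 'a set"
  where "rng_shift D T l = (\<lambda>x. T x - l *\<^sub>C x) ` D"

definition simple_symmetric ::
    "enat \<Rightarrow> 'h::complex_hilbert set \<Rightarrow> ('h \<Rightarrow> 'h) \<Rightarrow> bool"
  where "simple_symmetric n D T \<longleftrightarrow>
    closed_densely_defined D T \<and>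
    (\<forall>x\<in>D. \<forall>y\<in>D. cinner (T x) y = cinner x (T y)) \<and>
    (\<Inter>l\<in>nonreal. rng_shift D T l) = {0} \<and>
    has_hilbert_dim (corthogonal_comp (rng_shift D T \<i>)) n \<and>
    has_hilbert_dim (corthogonal_comp (rng_shift D T (- \<i>))) n"

text \<open>In the second condition the inverse is bounded, by the open mapping theorem or by the third
  condition with \<open>z = l\<close>.\<close>

definition is_model ::
    "'h::complex_hilbert set \<Rightarrow> ('h \<Rightarrow> 'h) \<Rightarrow> (complex \<Rightarrow> 'k::complex_hilbert \<Rightarrow>\<^sub>L 'h) \<Rightarrow> bool"
  where "is_model D T \<Gamma> \<longleftrightarrow>
    (\<forall>l\<in>nonreal. \<Gamma> l \<in> bounded_ops) \<and>
    vec_coholomorphic_on \<Gamma> nonreal \<and>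
    (\<forall>l\<in>nonreal. bij_betw (blinfun_apply (\<Gamma> l)) UNIV (corthogonal_comp (rng_shift D T l))) \<and>
    (\<forall>l z. (l \<in> upper_half \<and> z \<in> upper_half) \<or> (l \<in> lower_half \<and> z \<in> lower_half) \<longrightarrow>
      op_invertible (op_adj (\<Gamma> z) o\<^sub>L \<Gamma> l)) \<and>
    closure (cspan (\<Union>l\<in>nonreal. range (blinfun_apply (\<Gamma> l)))) = UNIV"


section \<open>The functions built from a model\<close>

definition model_kernel ::
    "(complex \<Rightarrow> 'k::complex_hilbert \<Rightarrow>\<^sub>L 'h::complex_hilbert) \<Rightarrow> complex \<Rightarrow> complex \<Rightarrow> 'k \<Rightarrow>\<^sub>L 'k"
  where "model_kernel \<Gamma> l z = op_adj (\<Gamma> z) o\<^sub>L \<Gamma> l"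

definition blaschke :: "complex \<Rightarrow> complex"
  where "blaschke z = (z - \<i>) / (z + \<i>)"

definition model_Phi ::
    "(complex \<Rightarrow> 'k::complex_hilbert \<Rightarrow>\<^sub>L 'h::complex_hilbert) \<Rightarrow> complex \<Rightarrow> 'k \<Rightarrow>\<^sub>L 'k"
  where "model_Phi \<Gamma> z = model_kernel \<Gamma> \<i> z o\<^sub>L op_inverse (op_sqrt (model_kernel \<Gamma> \<i> \<i>))"

definition model_Psi ::
    "(complex \<Rightarrow> 'k::complex_hilbert \<Rightarrow>\<^sub>L 'h::complex_hilbert) \<Rightarrow> complex \<Rightarrow> 'k \<Rightarrow>\<^sub>L 'k"
  where "model_Psi \<Gamma> z =
    model_kernel \<Gamma> (- \<i>) z o\<^sub>L op_inverse (op_sqrt (model_kernel \<Gamma> (- \<i>) (- \<i>)))"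

definition model_V ::
    "(complex \<Rightarrow> 'k::complex_hilbert \<Rightarrow>\<^sub>L 'h::complex_hilbert) \<Rightarrow> complex \<Rightarrow> 'k \<Rightarrow>\<^sub>L 'k"
  where "model_V \<Gamma> z = blaschke z *\<^sub>C (op_inverse (model_Phi \<Gamma> z) o\<^sub>L model_Psi \<Gamma> z)"

definition kernel_formula ::
    "(complex \<Rightarrow> 'k::complex_hilbert \<Rightarrow>\<^sub>L 'h::complex_hilbert) \<Rightarrow> complex \<Rightarrow> complex \<Rightarrow> 'k \<Rightarrow>\<^sub>L 'k"
  where "kernel_formula \<Gamma> l z =
    model_Phi \<Gamma> z o\<^sub>L
    ((1 / (1 - cnj (blaschke l) * blaschke z)) *\<^sub>C
      (id_blinfun - (model_V \<Gamma> z o\<^sub>L op_adj (model_V \<Gamma> l)))) o\<^sub>L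
    op_adj (model_Phi \<Gamma> l)"

text \<open>The pairs at which every factor of \<^const>\<open>kernel_formula\<close> is defined: no pole of
  \<^const>\<open>blaschke\<close>, no missing inverse and no vanishing denominator.\<close>

definition regular_pairs ::
    "(complex \<Rightarrow> 'k::complex_hilbert \<Rightarrow>\<^sub>L 'h::complex_hilbert) \<Rightarrow> (complex \<times> complex) set"
  where "regular_pairs \<Gamma> =
    {(l, z). l \<in> nonreal \<and> z \<in> nonreal \<and> l \<noteq> - \<i> \<and> z \<noteq> - \<i> \<and>
      op_invertible (model_Phi \<Gamma> l) \<and> op_invertible (model_Phi \<Gamma> z) \<and>
      1 - cnj (blaschke l) * blaschke z \<noteq> 0}"

end

(* Write P and Q for the orthogonal projections onto Rng(T - i)^perp and Rng(T + i)^perp. Since P is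
   \<Gamma>(i) K_i(i)^{-1} \<Gamma>(i)^*, the products \<Phi>(z) \<Phi>(l)^* and \<Psi>(z) \<Psi>(l)^* are \<Gamma>(z)^* P \<Gamma>(l) and \<Gamma>(z)^* Q \<Gamma>(l).
   For u in Rng(T - l)^perp the adjoint of the Cayley transform maps (1 - P) u to cnj (b l) (1 - Q) u;
   it is isometric on Rng(T - i), so \<Gamma>(z)^* (1 - P) \<Gamma>(l) = cnj (b l) b(z) \<Gamma>(z)^* (1 - Q) \<Gamma>(l), which is
   the kernel formula with its poles cancelled. On the diagonal it exhibits 1 - V(z) V(z)^* as a strictly
   positive operator for z in the upper half plane. Meromorphy of \<Phi>^{-1} for finite n is
   Cramer's rule. *)

theory Submission
  imports Defs "HOL-Complex_Analysis.Conformal_Mappings" "Jordan_Normal_Form.Determinant"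
begin

text \<open>The factor b is a quotient of eigenvalue shifts: a vector w of Rng(T - k)^perp satisfies
  <T y, w> = k <y, w>, so pairing it with T - \<i> and T + \<i> yields k - \<i> and k + \<i>. For l
  and z other than -\<i>, the denominator vanishes exactly when z = cnj l. The third model condition
  makes \<Phi>(z) invertible in the upper half plane, where z lies on the side of \<i>; in the lower
  half plane a determinant has to decide, and there the finiteness of n enters. In infinite
  dimension a strict inequality at each vector would only give norm at most 1, so positivity is
  carried as a uniform lower bound. A bound of the same kind yields the square roots by a fixed
  point argument and makes them unique. Operators are elements of a space of real-linear maps, so
  complex linearity has to be tracked through adjoints, inverses and limits.\<close>

instance complex_hilbert \<subseteq> banach ..

section \<open>Complex inner products\<close>

lemma scaleC_zero_left [simp]: "0 *\<^sub>C x = 0"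
  by (rule complex_vector.scale_zero_left)

lemma scaleC_zero_right [simp]: "a *\<^sub>C 0 = 0"
  by (rule complex_vector.scale_zero_right)

lemma scaleC_one [simp]: "1 *\<^sub>C x = x"
  by (rule complex_vector.scale_one)

lemma scaleR_scaleC: "r *\<^sub>R x = of_real r *\<^sub>C x"
  by (simp add: scaleC_of_real)

lemma bounded_bilinear_scaleC:
  "bounded_bilinear (scaleC :: complex \<Rightarrow> 'a \<Rightarrow> 'a::complex_normed_vector)"
proof
  show "\<exists>K. \<forall>a b. norm (a *\<^sub>C b :: 'a) \<le> norm a * norm b * K"
    by (rule exI[of _ 1]) (simp add: norm_scaleC)
  show "a *\<^sub>C (r *\<^sub>R b) = r *\<^sub>R (a *\<^sub>C b)" for a r and b :: 'a
    by (simp add: scaleR_scaleC[of _ b] scaleR_scaleC[of _ "a *\<^sub>C b"] scaleC_scaleC mult.commute)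
  show "(r *\<^sub>R a) *\<^sub>C b = r *\<^sub>R (a *\<^sub>C b)" for a r and b :: 'a
    by (simp add: scaleR_conv_of_real scaleR_scaleC[of _ "a *\<^sub>C b"] scaleC_scaleC)
qed (auto simp: scaleC_add_left scaleC_add_right)

lemma cinner_add_right: "cinner x (y + z) = cinner x y + cinner x z"
  by (simp add: cinner_commute[of x] cinner_add_left)

lemma cinner_scaleC_right: "cinner x (a *\<^sub>C y) = cnj a * cinner x y"
  by (simp add: cinner_commute[of x] cinner_scaleC_left)

lemma cinner_zero_left [simp]: "cinner 0 y = 0"
  using cinner_scaleC_left[of 0 0 y] by simp

lemma cinner_zero_right [simp]: "cinner x 0 = 0"
  using cinner_scaleC_right[of x 0 0] by simp

lemma cinner_minus_left: "cinner (- x) y = - cinner x y"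
  using cinner_scaleC_left[of "-1" x y] by simp

lemma cinner_minus_right: "cinner x (- y) = - cinner x y"
  using cinner_scaleC_right[of x "-1" y] by simp

lemma cinner_diff_left: "cinner (x - y) z = cinner x z - cinner y z"
  using cinner_add_left[of x "- y" z] by (simp add: cinner_minus_left)

lemma cinner_diff_right: "cinner x (y - z) = cinner x y - cinner x z"
  using cinner_add_right[of x y "- z"] by (simp add: cinner_minus_right)

lemma cinner_sum_left: "cinner (\<Sum>i\<in>I. f i) y = (\<Sum>i\<in>I. cinner (f i) y)"
  by (induction I rule: infinite_finite_induct) (auto simp: cinner_add_left)

lemmas cinner_simps = cinner_add_left cinner_add_right cinner_diff_left cinner_diff_right
  cinner_scaleC_left cinner_scaleC_right cinner_minus_left cinner_minus_right

lemma cinner_self: "cinner x x = of_real ((norm x)\<^sup>2)"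
proof (rule complex_eqI)
  show "Re (cinner x x) = Re (of_real ((norm x)\<^sup>2))"
    by (simp only: Re_cinner Re_complex_of_real power2_norm_eq_inner)
  show "Im (cinner x x) = Im (of_real ((norm x)\<^sup>2))"
    using arg_cong[OF cinner_commute[of x x], of Im] by simp
qed

lemma cinner_eq_zero_iff [simp]: "cinner x x = 0 \<longleftrightarrow> x = 0"
  by (simp add: cinner_self)

lemma norm_cinner_le: "cmod (cinner x y) \<le> norm x * norm y"
proof (cases "cinner x y = 0")
  case False
  \<comment> \<open>A unimodular factor that rotates \<open>cinner x y\<close> onto the positive
    axis, where the real Cauchy-Schwarz inequality applies.\<close>
  define a where "a = cnj (cinner x y) / cmod (cinner x y)"
  have "a * cinner x y = of_real (cmod (cinner x y))"
    using False by (simp add: a_def complex_norm_square[symmetric] power2_eq_square field_simps)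
  then have "cmod (cinner x y) = Re (cinner (a *\<^sub>C x) y)"
    by (simp add: cinner_scaleC_left)
  also have "\<dots> \<le> norm (a *\<^sub>C x) * norm y"
    unfolding Re_cinner by (rule norm_cauchy_schwarz)
  also have "norm (a *\<^sub>C x) = norm x"
    using False by (simp add: norm_scaleC a_def norm_divide)
  finally show ?thesis .
qed simp

lemma bounded_bilinear_cinner:
  "bounded_bilinear (cinner :: 'a::complex_inner \<Rightarrow> 'a \<Rightarrow> complex)"
proof
  show "\<exists>K. \<forall>a b::'a. norm (cinner a b) \<le> norm a * norm b * K"
    by (rule exI[of _ 1]) (simp add: norm_cinner_le)
  show "cinner (r *\<^sub>R a) b = r *\<^sub>R cinner a b" for r and a b :: 'a
    by (simp add: scaleR_scaleC[of _ a] cinner_scaleC_left scaleR_conv_of_real)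
  show "cinner a (r *\<^sub>R b) = r *\<^sub>R cinner a b" for r and a b :: 'a
    by (simp add: scaleR_scaleC[of _ b] cinner_scaleC_right scaleR_conv_of_real)
qed (auto simp: cinner_simps)

lemma cinner_ext_right: "(\<And>x. cinner x y = cinner x z) \<Longrightarrow> y = z"
  using cinner_eq_zero_iff[of "y - z"] by (simp add: cinner_diff_right del: cinner_eq_zero_iff)

lemma cinner_ext_left: "(\<And>y. cinner x y = cinner z y) \<Longrightarrow> x = z"
  using cinner_eq_zero_iff[of "x - z"] by (simp add: cinner_diff_left del: cinner_eq_zero_iff)

section \<open>Orthogonal projection and the adjoint\<close>

text \<open>A minimising sequence is Cauchy by the parallelogram law, since midpoints stay in
  \<open>M\<close> and cannot be closer to \<open>x\<close> than the infimum. Only the real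
  structure occurs, so the result serves real functionals as well as complex subspaces.\<close>

lemma closest_point_exists:
  fixes M :: "'a::{real_inner, complete_space} set"
  assumes cl: "closed M" and sub: "subspace M"
  obtains m where "m \<in> M" "\<And>y. y \<in> M \<Longrightarrow> dist x m \<le> dist x y"
proof -
  have ne: "M \<noteq> {}" using sub subspace_0 by blast
  define d where "d = infdist x M"
  have d0: "0 \<le> d" by (simp add: d_def infdist_nonneg)
  have le: "d \<le> dist x y" if "y \<in> M" for y
    using that by (simp add: d_def infdist_le)
  have "\<exists>y\<in>M. dist x y < d + inverse (Suc k)" for k :: nat
  proof (rule ccontr)
    assume "\<not> ?thesis"
    then have "d + inverse (Suc k) \<le> infdist x M"
      unfolding infdist_notempty[OF ne] by (intro cINF_greatest[OF ne]) (auto simp: not_less)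
    then show False by (simp add: d_def)
  qed
  then obtain y where yM: "\<And>k. y k \<in> M" and yd: "\<And>k. dist x (y k) < d + inverse (Suc k)"
    by metis
  have bound: "(dist (y j) (y k))\<^sup>2 \<le> 4 * (2 * d + 1) * inverse (Suc N)"
    if "N \<le> j" "N \<le> k" for j k N
  proof -
    \<comment> \<open>\<open>e\<close> bounds the excess of all terms from \<open>N\<close> on;
      \<open>e \<le> 1\<close> later makes the factor \<open>2 * d + e\<close> independent of
      \<open>N\<close>.\<close>
    define e where "e = inverse (real (Suc N))"
    have e: "0 < e" "e \<le> 1" by (auto simp: e_def inverse_le_1_iff)
    have b: "(dist x (y i))\<^sup>2 \<le> (d + e)\<^sup>2" if "N \<le> i" for i
    proof -
      have "inverse (real (Suc i)) \<le> e"
        using that by (simp add: e_def field_simps)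
      then have "dist x (y i) \<le> d + e" using yd[of i] by simp
      then show ?thesis by (rule power_mono) simp
    qed
    have "(1/2) *\<^sub>R (y j + y k) \<in> M"
      using sub yM by (simp add: subspace_add subspace_mul)
    from le[OF this] have "d\<^sup>2 \<le> (norm (x - (1/2) *\<^sub>R (y j + y k)))\<^sup>2"
      unfolding dist_norm by (rule power_mono) (rule d0)
    moreover have "(norm (y j - y k))\<^sup>2 + 4 * (norm (x - (1/2) *\<^sub>R (y j + y k)))\<^sup>2
        = 2 * (norm (x - y j))\<^sup>2 + 2 * (norm (x - y k))\<^sup>2"
      by (simp add: power2_norm_eq_inner inner_simps inner_commute algebra_simps)
    ultimately have "(norm (y j - y k))\<^sup>2 \<le> 4 * (d + e)\<^sup>2 - 4 * d\<^sup>2"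
      using b[OF that(1)] b[OF that(2)] unfolding dist_norm by linarith
    also have "\<dots> = 4 * (2 * d + e) * e" by (simp add: power2_eq_square algebra_simps)
    also have "\<dots> \<le> 4 * (2 * d + 1) * e" using e d0 by (intro mult_right_mono) auto
    finally show ?thesis by (simp add: dist_norm e_def)
  qed
  have "Cauchy y"
  proof (rule metric_CauchyI)
    fix \<epsilon> :: real assume "0 < \<epsilon>"
    have "(\<lambda>N. 4 * (2 * d + 1) * inverse (real (Suc N))) \<longlonglongrightarrow> 4 * (2 * d + 1) * 0"
      by (intro tendsto_mult tendsto_const LIMSEQ_inverse_real_of_nat)
    then have "eventually (\<lambda>N. 4 * (2 * d + 1) * inverse (real (Suc N)) < \<epsilon>\<^sup>2) sequentially"
      using \<open>0 < \<epsilon>\<close> by (intro order_tendstoD) auto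
    then obtain N where N: "4 * (2 * d + 1) * inverse (real (Suc N)) < \<epsilon>\<^sup>2"
      by (auto simp: eventually_sequentially)
    show "\<exists>N. \<forall>j\<ge>N. \<forall>k\<ge>N. dist (y j) (y k) < \<epsilon>"
    proof (intro exI allI impI)
      fix j k assume "N \<le> j" "N \<le> k"
      from bound[OF this] N have "(dist (y j) (y k))\<^sup>2 < \<epsilon>\<^sup>2" by linarith
      then show "dist (y j) (y k) < \<epsilon>" using \<open>0 < \<epsilon>\<close> by (auto intro: power2_less_imp_less)
    qed
  qed
  then obtain m where m: "y \<longlonglongrightarrow> m" using Cauchy_convergent convergent_def by blast
  have "m \<in> M" using closed_sequentially[OF cl] yM m by blast
  moreover have "dist x m \<le> dist x v" if "v \<in> M" for v
  proof -
    have "dist x m \<le> d + 0"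
    proof (rule LIMSEQ_le)
      show "(\<lambda>k. dist x (y k)) \<longlonglongrightarrow> dist x m" by (intro tendsto_dist tendsto_const m)
      show "(\<lambda>k. d + inverse (real (Suc k))) \<longlonglongrightarrow> d + 0"
        by (intro tendsto_add tendsto_const LIMSEQ_inverse_real_of_nat)
      show "\<exists>N. \<forall>n\<ge>N. dist x (y n) \<le> d + inverse (real (Suc n))"
        using yd less_imp_le by blast
    qed
    then show ?thesis using le[OF that] by simp
  qed
  ultimately show thesis using that by blast
qed

lemma orthogonal_decomposition:
  fixes M :: "'a::{real_inner, complete_space} set"
  assumes cl: "closed M" and sub: "subspace M"
  obtains m where "m \<in> M" "\<And>v. v \<in> M \<Longrightarrow> inner (x - m) v = 0"
proof -
  obtain m where m: "m \<in> M" and min: "\<And>y. y \<in> M \<Longrightarrow> dist x m \<le> dist x y"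
    using closest_point_exists[OF cl sub] by metis
  have "inner (x - m) v = 0" if v: "v \<in> M" for v
  proof (cases "v = 0")
    case False
    \<comment> \<open>The minimiser of the squared distance from \<open>x\<close> along the line
      through \<open>m\<close> in direction \<open>v\<close>. A step of this size would lower the
      square by \<open>(inner (x - m) v)\<^sup>2 / inner v v\<close>.\<close>
    define t where "t = inner (x - m) v / inner v v"
    have "m + t *\<^sub>R v \<in> M" using m v sub by (simp add: subspace_add subspace_mul)
    from min[OF this] have "(norm (x - m))\<^sup>2 \<le> (norm (x - m - t *\<^sub>R v))\<^sup>2"
      unfolding dist_norm by (intro power_mono) (auto simp: algebra_simps)
    also have "\<dots> = (norm (x - m))\<^sup>2 - 2 * t * inner (x - m) v + t * (t * inner v v)"
      unfolding power2_norm_eq_inner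
      by (simp only: inner_diff_left inner_diff_right inner_scaleR_left inner_scaleR_right)
        (simp add: inner_commute algebra_simps)
    also have "t * inner v v = inner (x - m) v" using False by (simp add: t_def)
    finally have "t * inner (x - m) v \<le> 0" by simp
    moreover have "t * inner (x - m) v = (inner (x - m) v)\<^sup>2 / inner v v"
      by (simp add: t_def power2_eq_square)
    ultimately show ?thesis using False inner_gt_zero_iff[of v] by (simp add: divide_le_0_iff not_le[symmetric])
  qed simp
  with m show thesis using that by blast
qed

text \<open>The representing vector is a rescaled normal \<open>u\<close> of the kernel:
  \<open>f u *\<^sub>R x - f x *\<^sub>R u\<close> lies in the kernel for every \<open>x\<close>,
  and its orthogonality to \<open>u\<close> determines \<open>f x\<close>.\<close>

lemma riesz_representation:
  fixes f :: "'a::{real_inner, complete_space} \<Rightarrow> real"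
  assumes f: "bounded_linear f"
  shows "\<exists>y. \<forall>x. f x = inner x y"
proof (cases "\<forall>x. f x = 0")
  case True
  then show ?thesis by (intro exI[of _ 0]) simp
next
  case False
  interpret f: bounded_linear f by (rule f)
  define M where "M = {x. f x = 0}"
  have "closed M" unfolding M_def
    by (intro closed_Collect_eq continuous_intros f.continuous_on)
  moreover have "subspace M" by (auto simp: M_def subspace_def f.add f.scaleR f.zero)
  moreover obtain x0 where x0: "f x0 \<noteq> 0" using False by blast
  ultimately obtain m where m: "m \<in> M" and orth: "\<And>v. v \<in> M \<Longrightarrow> inner (x0 - m) v = 0"
    using orthogonal_decomposition[of M] by metis
  define u where "u = x0 - m"
  have fu: "f u = f x0" using m by (simp add: u_def f.diff M_def)
  then have u: "u \<noteq> 0" using x0 f.zero by auto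
  have "f x = inner x ((f u / inner u u) *\<^sub>R u)" for x
  proof -
    have "f u *\<^sub>R x - f x *\<^sub>R u \<in> M" by (simp add: M_def f.diff f.scaleR)
    from orth[OF this] have "f u * inner u x = f x * inner u u"
      by (simp add: u_def[symmetric] inner_diff_right)
    then show ?thesis using u by (simp add: inner_commute field_simps)
  qed
  then show ?thesis by blast
qed

section \<open>Complex-linear operators and their adjoints\<close>

lemma bounded_opsD: "A \<in> bounded_ops \<Longrightarrow> blinfun_apply A (c *\<^sub>C x) = c *\<^sub>C blinfun_apply A x"
  by (simp add: bounded_ops_def)

lemma bounded_opsI: "(\<And>c x. blinfun_apply A (c *\<^sub>C x) = c *\<^sub>C blinfun_apply A x) \<Longrightarrow> A \<in> bounded_ops"
  by (simp add: bounded_ops_def)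

text \<open>The real Riesz theorem provides the adjoint relation for real parts. Complex linearity
  of \<open>A\<close> then settles the imaginary parts, because Im w = - Re (\<i> w).\<close>

lemma op_adj_exists:
  fixes A :: "'a::complex_hilbert \<Rightarrow>\<^sub>L 'b::complex_hilbert"
  assumes A: "A \<in> bounded_ops"
  shows "\<exists>B::'b \<Rightarrow>\<^sub>L 'a. \<forall>x y. cinner (blinfun_apply A x) y = cinner x (blinfun_apply B y)"
proof -
  have "\<exists>z. \<forall>x. inner (blinfun_apply A x) y = inner x z" for y
    by (rule riesz_representation) (intro bounded_linear_intros)
  then obtain b where b: "\<And>x y. inner (blinfun_apply A x) y = inner x (b y)" by metis
  have bc: "cinner (blinfun_apply A x) y = cinner x (b y)" for x y
  proof (rule complex_eqI)
    show "Re (cinner (blinfun_apply A x) y) = Re (cinner x (b y))"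
      by (simp add: Re_cinner b)
    have "Im (cinner (blinfun_apply A x) y) = - Re (cinner (blinfun_apply A (\<i> *\<^sub>C x)) y)"
      by (simp add: bounded_opsD[OF A] cinner_scaleC_left)
    also have "\<dots> = - Re (cinner (\<i> *\<^sub>C x) (b y))" by (simp only: Re_cinner b)
    finally show "Im (cinner (blinfun_apply A x) y) = Im (cinner x (b y))"
      by (simp add: cinner_scaleC_left)
  qed
  have "bounded_linear b"
  proof (rule bounded_linear_intro[where K = "norm A"])
    show "b (x + y) = b x + b y" for x y
      by (rule cinner_ext_right) (simp add: bc[symmetric] cinner_add_right)
    show "b (r *\<^sub>R x) = r *\<^sub>R b x" for r x
      by (rule cinner_ext_right) (simp add: bc[symmetric] cinner_scaleC_right scaleR_scaleC)
    show "norm (b y) \<le> norm y * norm A" for y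
    proof (cases "b y = 0")
      case False
      have "(norm (b y))\<^sup>2 = inner (blinfun_apply A (b y)) y"
        by (simp add: b power2_norm_eq_inner)
      also have "\<dots> \<le> norm (blinfun_apply A (b y)) * norm y" by (rule norm_cauchy_schwarz)
      also have "\<dots> \<le> norm A * norm (b y) * norm y"
        by (intro mult_right_mono norm_blinfun) simp
      finally have "norm (b y) * norm (b y) \<le> norm (b y) * (norm y * norm A)"
        by (simp add: power2_eq_square mult_ac)
      then show ?thesis using False by simp
    qed simp
  qed
  then show ?thesis
    by (intro exI[of _ "Blinfun b"]) (simp add: bc bounded_linear_Blinfun_apply)
qed

lemma op_adj_eqI:
  assumes "\<And>x y. cinner (blinfun_apply A x) y = cinner x (blinfun_apply B y)"
  shows "op_adj A = B"
  unfolding op_adj_def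
proof (rule the_equality)
  fix C
  assume C: "\<forall>x y. cinner (blinfun_apply A x) y = cinner x (blinfun_apply C y)"
  show "C = B"
    by (rule blinfun_eqI, rule cinner_ext_right) (simp add: C[rule_format, symmetric] assms)
qed (use assms in blast)

lemma cinner_op_adj_right:
  "A \<in> bounded_ops \<Longrightarrow> cinner x (blinfun_apply (op_adj A) y) = cinner (blinfun_apply A x) y"
  using op_adj_exists[of A] op_adj_eqI[of A] by force

lemma cinner_op_adj_left:
  "A \<in> bounded_ops \<Longrightarrow> cinner (blinfun_apply (op_adj A) x) y = cinner x (blinfun_apply A y)"
  using cinner_op_adj_right[of A y x]
  by (simp add: cinner_commute[of _ y] cinner_commute[of "blinfun_apply (op_adj A) x" y]
      cinner_commute[of x])

lemma op_adj_bounded_ops [simp]: "A \<in> bounded_ops \<Longrightarrow> op_adj A \<in> bounded_ops"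
  by (rule bounded_opsI, rule cinner_ext_right)
    (simp add: cinner_op_adj_right cinner_scaleC_right)

lemma op_adj_op_adj [simp]: "A \<in> bounded_ops \<Longrightarrow> op_adj (op_adj A) = A"
  by (rule op_adj_eqI) (simp add: cinner_op_adj_left)

lemma bounded_ops_compose [simp]: "A \<in> bounded_ops \<Longrightarrow> B \<in> bounded_ops \<Longrightarrow> A o\<^sub>L B \<in> bounded_ops"
  by (simp add: bounded_ops_def)

lemma bounded_ops_scaleC [simp]: "A \<in> bounded_ops \<Longrightarrow> c *\<^sub>C A \<in> bounded_ops"
  by (simp add: bounded_ops_def scaleC_blinfun.rep_eq scaleC_scaleC mult.commute)

lemma bounded_ops_diff [simp]: "A \<in> bounded_ops \<Longrightarrow> B \<in> bounded_ops \<Longrightarrow> A - B \<in> bounded_ops"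
  by (simp add: bounded_ops_def blinfun.diff_left complex_vector.scale_right_diff_distrib)

lemma bounded_ops_add [simp]: "A \<in> bounded_ops \<Longrightarrow> B \<in> bounded_ops \<Longrightarrow> A + B \<in> bounded_ops"
  by (simp add: bounded_ops_def blinfun.add_left scaleC_add_right)

lemma bounded_ops_id [simp]: "id_blinfun \<in> bounded_ops"
  by (simp add: bounded_ops_def)

lemma bounded_ops_zero [simp]: "0 \<in> bounded_ops"
  by (simp add: bounded_ops_def)

lemma op_adj_compose:
  "A \<in> bounded_ops \<Longrightarrow> B \<in> bounded_ops \<Longrightarrow> op_adj (A o\<^sub>L B) = op_adj B o\<^sub>L op_adj A"
  by (rule op_adj_eqI) (simp add: cinner_op_adj_right)

lemma op_adj_scaleC: "A \<in> bounded_ops \<Longrightarrow> op_adj (c *\<^sub>C A) = cnj c *\<^sub>C op_adj A"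
  by (rule op_adj_eqI)
    (simp add: cinner_op_adj_right scaleC_blinfun.rep_eq cinner_scaleC_left cinner_scaleC_right)

lemma op_adj_diff:
  "A \<in> bounded_ops \<Longrightarrow> B \<in> bounded_ops \<Longrightarrow> op_adj (A - B) = op_adj A - op_adj B"
  by (rule op_adj_eqI) (simp add: cinner_op_adj_right blinfun.diff_left cinner_simps)

lemma norm_op_adj:
  assumes "A \<in> bounded_ops"
  shows "norm (op_adj A) = norm A"
proof -
  \<comment> \<open>Stated with type variables of its own, because it is applied to \<open>A\<close>
    and, in the opposite direction, to \<open>op_adj A\<close>.\<close>
  have le: "norm (op_adj B) \<le> norm B" if B: "B \<in> bounded_ops"
    for B :: "'c::complex_hilbert \<Rightarrow>\<^sub>L 'd::complex_hilbert"
  proof (rule norm_blinfun_bound)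
    fix y
    let ?v = "blinfun_apply (op_adj B) y"
    show "norm ?v \<le> norm B * norm y"
    proof (cases "?v = 0")
      case False
      have "(norm ?v)\<^sup>2 = cmod (cinner ?v ?v)" by (simp add: cinner_self norm_power)
      also have "\<dots> = cmod (cinner (blinfun_apply B ?v) y)"
        by (simp only: cinner_op_adj_right[OF B])
      also have "\<dots> \<le> norm (blinfun_apply B ?v) * norm y" by (rule norm_cinner_le)
      also have "\<dots> \<le> norm B * norm ?v * norm y"
        by (intro mult_right_mono norm_blinfun) simp
      finally have "norm ?v * norm ?v \<le> norm ?v * (norm B * norm y)"
        by (simp add: power2_eq_square mult_ac)
      then show ?thesis using False by simp
    qed simp
  qed simp
  show ?thesis using le[OF assms] le[of "op_adj A"] assms by simp
qed

section \<open>Inverses and square roots of operators\<close>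

interpretation blinfun_comp: bounded_bilinear
  "(o\<^sub>L) :: ('b::real_normed_vector \<Rightarrow>\<^sub>L 'c::real_normed_vector) \<Rightarrow> ('a::real_normed_vector \<Rightarrow>\<^sub>L 'b) \<Rightarrow> _"
  by (rule bounded_bilinear_blinfun_compose)

lemma blinfun_compose_id [simp]: "A o\<^sub>L id_blinfun = A" "id_blinfun o\<^sub>L A = A"
  by (rule blinfun_eqI, simp)+

lemma blinfun_compose_assoc: "(A o\<^sub>L B) o\<^sub>L C = A o\<^sub>L (B o\<^sub>L C)"
  by (rule blinfun_eqI) simp

lemma blinfun_compose_scaleC_left: "(c *\<^sub>C A) o\<^sub>L B = c *\<^sub>C (A o\<^sub>L B)"
  by (rule blinfun_eqI) (simp add: scaleC_blinfun.rep_eq)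

lemma blinfun_compose_scaleC_right: "A \<in> bounded_ops \<Longrightarrow> A o\<^sub>L (c *\<^sub>C B) = c *\<^sub>C (A o\<^sub>L B)"
  by (rule blinfun_eqI) (simp add: scaleC_blinfun.rep_eq bounded_opsD)

lemma op_inverse_eqI:
  assumes "A o\<^sub>L B = id_blinfun" "B o\<^sub>L A = id_blinfun"
  shows "op_inverse A = B" "op_invertible A"
proof -
  show inv: "op_invertible A" using assms by (auto simp: op_invertible_def)
  have "(THE B. A o\<^sub>L B = id_blinfun \<and> B o\<^sub>L A = id_blinfun) = B"
  proof (rule the_equality)
    fix C assume C: "A o\<^sub>L C = id_blinfun \<and> C o\<^sub>L A = id_blinfun"
    have "C = C o\<^sub>L (A o\<^sub>L B)" by (simp add: assms)
    also have "\<dots> = (C o\<^sub>L A) o\<^sub>L B" by (simp add: blinfun_compose_assoc)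
    also have "\<dots> = B" by (simp add: C)
    finally show "C = B" .
  qed (use assms in simp)
  with inv show "op_inverse A = B" by (simp add: op_inverse_def)
qed

lemma op_inverse_right: "op_invertible A \<Longrightarrow> A o\<^sub>L op_inverse A = id_blinfun"
  and op_inverse_left: "op_invertible A \<Longrightarrow> op_inverse A o\<^sub>L A = id_blinfun"
  using op_inverse_eqI(1)[of A] by (auto simp: op_invertible_def)

lemma op_inverse_apply_right: "op_invertible A \<Longrightarrow> blinfun_apply A (blinfun_apply (op_inverse A) x) = x"
  using op_inverse_right[of A] by (metis blinfun_apply_blinfun_compose blinfun_apply_id_blinfun)

lemma op_inverse_apply_left: "op_invertible A \<Longrightarrow> blinfun_apply (op_inverse A) (blinfun_apply A x) = x"
  using op_inverse_left[of A] by (metis blinfun_apply_blinfun_compose blinfun_apply_id_blinfun)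

lemma op_inverse_bounded_ops [simp]:
  assumes "A \<in> bounded_ops"
  shows "op_inverse A \<in> bounded_ops"
proof (cases "op_invertible A")
  case True
  show ?thesis
  proof (rule bounded_opsI)
    fix c x
    have "c *\<^sub>C x = blinfun_apply A (c *\<^sub>C blinfun_apply (op_inverse A) x)"
      by (simp add: bounded_opsD[OF assms] op_inverse_apply_right[OF True])
    then show "blinfun_apply (op_inverse A) (c *\<^sub>C x) = c *\<^sub>C blinfun_apply (op_inverse A) x"
      by (simp add: op_inverse_apply_left[OF True])
  qed
qed (simp add: op_inverse_def)

lemma op_invertible_compose:
  assumes "op_invertible A" "op_invertible B"
  shows "op_invertible (A o\<^sub>L B)"
proof (rule op_inverse_eqI(2)[where B = "op_inverse B o\<^sub>L op_inverse A"])
  show "(A o\<^sub>L B) o\<^sub>L (op_inverse B o\<^sub>L op_inverse A) = id_blinfun"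
    by (rule blinfun_eqI) (simp add: op_inverse_apply_right assms)
  show "(op_inverse B o\<^sub>L op_inverse A) o\<^sub>L (A o\<^sub>L B) = id_blinfun"
    by (rule blinfun_eqI) (simp add: op_inverse_apply_left assms)
qed

lemma op_invertible_op_inverse: "op_invertible A \<Longrightarrow> op_invertible (op_inverse A)"
  by (rule op_inverse_eqI(2)[where B = A]) (simp_all add: op_inverse_left op_inverse_right)

lemma op_inverse_adj:
  assumes "A \<in> bounded_ops" "op_invertible A"
  shows "op_inverse (op_adj A) = op_adj (op_inverse A)" "op_invertible (op_adj A)"
proof -
  have id: "op_adj (id_blinfun :: 'a \<Rightarrow>\<^sub>L 'a) = id_blinfun"
    by (rule op_adj_eqI) simp
  have *: "op_adj A o\<^sub>L op_adj (op_inverse A) = id_blinfun"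
    "op_adj (op_inverse A) o\<^sub>L op_adj A = id_blinfun"
    using assms by (simp_all add: op_adj_compose[symmetric] op_inverse_left op_inverse_right id)
  show "op_inverse (op_adj A) = op_adj (op_inverse A)" "op_invertible (op_adj A)"
    by (rule op_inverse_eqI[OF *])+
qed

section \<open>Positive operators and their square roots\<close>

lemma positive_op_self_adjoint:
  assumes "positive_op A"
  shows "cinner (blinfun_apply A x) y = cinner x (blinfun_apply A y)"
proof -
  have A: "A \<in> bounded_ops" and pos: "\<And>x. cinner (blinfun_apply A x) x \<in> \<real>\<^sub>\<ge>\<^sub>0"
    using assms by (auto simp: positive_op_def)
  \<comment> \<open>The form that measures the failure of self-adjointness. It vanishes on the
    diagonal because the quadratic form is real; polarisation at \<open>x + y\<close> makes it
    antisymmetric, polarisation at \<open>x + \<i> *\<^sub>C y\<close> makes it symmetric.\<close>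
  define s where "s x y = cinner (blinfun_apply A x) y - cinner x (blinfun_apply A y)" for x y
  have s0: "s x x = 0" for x
  proof -
    have "cnj (cinner (blinfun_apply A x) x) = cinner (blinfun_apply A x) x"
      using pos[of x] nonneg_Reals_subset_Reals Reals_cnj_iff by blast
    then show ?thesis by (simp add: s_def cinner_commute[of x])
  qed
  have "s (x + y) (x + y) = s x x + s x y + s y x + s y y"
    by (simp add: s_def blinfun.add_right cinner_simps)
  then have 1: "s x y + s y x = 0" by (simp add: s0)
  have "s (x + \<i> *\<^sub>C y) (x + \<i> *\<^sub>C y) = s x x - \<i> * s x y + \<i> * s y x + s y y"
    by (simp add: s_def blinfun.add_right bounded_opsD[OF A] cinner_simps algebra_simps)
  then have "\<i> * (s y x - s x y) = 0" by (simp add: s0 algebra_simps)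
  then have "s y x = s x y" by simp
  with 1 show ?thesis by (simp add: s_def)
qed

text \<open>Lets complex linearity survive limits: in the fixed point argument for square roots, for
  limits of difference quotients, and at the centre of a Laurent expansion.\<close>

lemma closed_bounded_ops: "closed bounded_ops"
proof -
  have "continuous_on UNIV (\<lambda>A::'a \<Rightarrow>\<^sub>L 'b. blinfun_apply A (c *\<^sub>C x))"
    "continuous_on UNIV (\<lambda>A::'a \<Rightarrow>\<^sub>L 'b. c *\<^sub>C blinfun_apply A x)" for c x
    by (intro continuous_intros bounded_bilinear.continuous_on[OF bounded_bilinear_scaleC])+
  then show ?thesis
    unfolding bounded_ops_def by (intro closed_Collect_all closed_Collect_eq)
qed

text \<open>The iteration solves \<open>2 * Y = B + Y\<^sup>2\<close>, that is, \<open>(1 - Y)\<^sup>2 = 1 - B\<close>, by contraction in the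
  closed set of self-adjoint operators in the bicommutant of B; the radius satisfies
  \<open>norm B + r\<^sup>2 \<le> 2 * r\<close>.\<close>

lemma sqrt_near_id:
  fixes B :: "'a::complex_hilbert \<Rightarrow>\<^sub>L 'a"
  assumes B: "B \<in> bounded_ops" "\<And>x y. cinner (blinfun_apply B x) y = cinner x (blinfun_apply B y)"
    and norm_B: "norm B \<le> q" "q < 1"
  obtains Y r where "Y \<in> bounded_ops" "\<And>x y. cinner (blinfun_apply Y x) y = cinner x (blinfun_apply Y y)"
    "norm Y \<le> r" "r < 1" "(id_blinfun - Y) o\<^sub>L (id_blinfun - Y) = id_blinfun - B"
    "\<And>C. C o\<^sub>L B = B o\<^sub>L C \<Longrightarrow> C o\<^sub>L Y = Y o\<^sub>L C"
proof -
  \<comment> \<open>The smaller root of \<open>r\<^sup>2 - 2 * r + q = 0\<close>. With this radius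
    the map \<open>f\<close> below sends the ball into itself and contracts by the factor
    \<open>r\<close>, which is less than 1.\<close>
  define r where "r = 1 - sqrt (1 - q)"
  have q0: "0 \<le> q" using norm_B(1) norm_ge_zero order_trans by blast
  have r: "0 \<le> r" "r < 1" using norm_B q0 by (simp_all add: r_def)
  have rr: "q + r\<^sup>2 = 2 * r"
    using norm_B by (simp add: r_def power2_diff)
  \<comment> \<open>The last clause is carried along for the uniqueness of the root: a competing
    root commutes with the given operator and must then commute with the constructed one.\<close>
  define S where "S = {Y::'a \<Rightarrow>\<^sub>L 'a. norm Y \<le> r} \<inter> bounded_ops
    \<inter> {Y. \<forall>x y. cinner (blinfun_apply Y x) y = cinner x (blinfun_apply Y y)}
    \<inter> {Y. \<forall>C. C o\<^sub>L B = B o\<^sub>L C \<longrightarrow> C o\<^sub>L Y = Y o\<^sub>L C}"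
  define f where "f Y = (1/2) *\<^sub>R (B + (Y o\<^sub>L Y))" for Y
  have "\<exists>!Y\<in>S. f Y = Y"
  proof (rule Banach_fix[OF _ _ r])
    have "closed {Y::'a \<Rightarrow>\<^sub>L 'a. norm Y \<le> r}"
      by (intro closed_Collect_le continuous_intros)
    moreover have "closed {Y. \<forall>x y::'a. cinner (blinfun_apply Y x) y = cinner x (blinfun_apply Y y)}"
      by (intro closed_Collect_all closed_Collect_eq continuous_intros
          bounded_bilinear.continuous_on[OF bounded_bilinear_cinner])
    moreover have "closed {Y::'a \<Rightarrow>\<^sub>L 'a. \<forall>C. C o\<^sub>L B = B o\<^sub>L C \<longrightarrow> C o\<^sub>L Y = Y o\<^sub>L C}"
      by (intro closed_Collect_all closed_Collect_imp closed_Collect_eq open_Collect_const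
          continuous_intros blinfun_comp.continuous_on)
    ultimately have "closed S"
      unfolding S_def by (intro closed_Int closed_bounded_ops)
    then show "complete S" by (simp add: complete_eq_closed)
    have "0 \<in> S" using r by (simp add: S_def)
    then show "S \<noteq> {}" by blast
    show "f ` S \<subseteq> S"
    proof (rule image_subsetI)
      fix Y assume Y: "Y \<in> S"
      then have Yb: "Y \<in> bounded_ops"
        and Ysa: "\<And>x y. cinner (blinfun_apply Y x) y = cinner x (blinfun_apply Y y)"
        by (auto simp: S_def)
      have "norm (Y o\<^sub>L Y) \<le> norm Y * norm Y" by (rule norm_blinfun_compose)
      also have "\<dots> \<le> r\<^sup>2"
        using Y r by (auto simp: S_def power2_eq_square intro: mult_mono)
      finally have "norm (B + (Y o\<^sub>L Y)) \<le> q + r\<^sup>2"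
        using norm_B norm_triangle_ineq[of B "Y o\<^sub>L Y"] by linarith
      then have "norm (f Y) \<le> r" by (simp add: f_def rr)
      moreover have "f Y \<in> bounded_ops"
        using Yb B by (simp add: f_def scaleR_scaleC)
      moreover have "cinner (blinfun_apply (f Y) x) y = cinner x (blinfun_apply (f Y) y)" for x y
        using Ysa B by (simp add: f_def blinfun.add_left blinfun.scaleR_left cinner_simps
            scaleR_scaleC scaleC_blinfun.rep_eq)
      moreover have "C o\<^sub>L f Y = f Y o\<^sub>L C" if C: "C o\<^sub>L B = B o\<^sub>L C" for C
      proof -
        have CY: "C o\<^sub>L Y = Y o\<^sub>L C" using Y C unfolding S_def by blast
        have "C o\<^sub>L (Y o\<^sub>L Y) = (Y o\<^sub>L C) o\<^sub>L Y" by (simp add: CY[symmetric] blinfun_compose_assoc)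
        also have "\<dots> = (Y o\<^sub>L Y) o\<^sub>L C" by (simp add: CY blinfun_compose_assoc)
        finally show ?thesis
          by (simp add: f_def blinfun_comp.scaleR_left blinfun_comp.scaleR_right
              blinfun_comp.add_left blinfun_comp.add_right C)
      qed
      ultimately show "f Y \<in> S" unfolding S_def by blast
    qed
    show "dist (f Y) (f Z) \<le> r * dist Y Z" if "Y \<in> S" "Z \<in> S" for Y Z
    proof -
      \<comment> \<open>Telescoping of half of \<open>Y\<^sup>2 - Z\<^sup>2\<close>, valid without
        commuting the factors.\<close>
      have "f Y - f Z = (1/2) *\<^sub>R ((Y o\<^sub>L (Y - Z)) + ((Y - Z) o\<^sub>L Z))"
        by (simp add: f_def blinfun_comp.diff_left blinfun_comp.diff_right scaleR_diff_right[symmetric])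
      then have "norm (f Y - f Z) \<le> (1/2) * (norm (Y o\<^sub>L (Y - Z)) + norm ((Y - Z) o\<^sub>L Z))"
        using norm_triangle_ineq[of "Y o\<^sub>L (Y - Z)" "(Y - Z) o\<^sub>L Z"] by simp
      also have "\<dots> \<le> (1/2) * (norm Y * norm (Y - Z) + norm (Y - Z) * norm Z)"
        by (intro mult_left_mono add_mono norm_blinfun_compose) simp
      also have "\<dots> \<le> (1/2) * (r * norm (Y - Z) + norm (Y - Z) * r)"
        using that by (intro mult_left_mono add_mono mult_right_mono) (auto simp: S_def)
      finally show ?thesis by (simp add: dist_norm)
    qed
  qed
  then obtain Y where Y: "Y \<in> S" "f Y = Y" by blast
  have "2 *\<^sub>R Y = B + (Y o\<^sub>L Y)"
    using arg_cong[OF Y(2), of "\<lambda>X. 2 *\<^sub>R X"] by (simp add: f_def)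
  then have "(id_blinfun - Y) o\<^sub>L (id_blinfun - Y) = id_blinfun - B"
    by (simp add: blinfun_comp.diff_left blinfun_comp.diff_right scaleR_2 algebra_simps)
  with Y r show thesis using that[of Y r] by (auto simp: S_def)
qed

text \<open>Another root \<open>B\<close> commutes with its square \<open>A\<close>, hence with
  \<open>S\<close>, and so \<open>(S + B) o\<^sub>L (S - B) = 0\<close>. The lower bound on
  \<open>S\<close> together with the positivity of \<open>B\<close> makes \<open>S + B\<close>
  injective.\<close>

lemma op_sqrt_unique:
  fixes A S :: "'a::complex_hilbert \<Rightarrow>\<^sub>L 'a"
  assumes S: "positive_op S" "S o\<^sub>L S = A" "\<And>C. C o\<^sub>L A = A o\<^sub>L C \<Longrightarrow> C o\<^sub>L S = S o\<^sub>L C"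
    and d: "0 < d" "\<And>x. d * (norm x)\<^sup>2 \<le> Re (cinner (blinfun_apply S x) x)"
  shows "op_sqrt A = S"
  unfolding op_sqrt_def
proof (rule the_equality)
  fix B assume B: "positive_op B \<and> B o\<^sub>L B = A"
  then have "B o\<^sub>L A = A o\<^sub>L B" by (metis blinfun_compose_assoc)
  then have BS: "B o\<^sub>L S = S o\<^sub>L B" by (rule S(3))
  show "B = S"
  proof (rule blinfun_eqI)
    fix x
    define y where "y = blinfun_apply S x - blinfun_apply B x"
    have prod0: "(S + B) o\<^sub>L (S - B) = 0"
      using B S(2) BS by (simp add: blinfun_comp.add_left blinfun_comp.diff_right)
    have "blinfun_apply (S + B) y = 0"
      using arg_cong[OF prod0, of "\<lambda>X. blinfun_apply X x"] by (simp add: y_def blinfun.diff_left)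
    then have "0 = Re (cinner (blinfun_apply S y) y) + Re (cinner (blinfun_apply B y) y)"
      by (metis blinfun.add_left cinner_add_left cinner_zero_left plus_complex.sel(1) zero_complex.sel(1))
    moreover have "0 \<le> Re (cinner (blinfun_apply B y) y)"
      using B by (auto simp: positive_op_def complex_nonneg_Reals_iff)
    ultimately have "d * (norm y)\<^sup>2 \<le> 0" using d(2)[of y] by linarith
    then have "y = 0" using d(1) by (simp add: mult_le_0_iff)
    then show "blinfun_apply B x = blinfun_apply S x" by (simp add: y_def)
  qed
qed (use S(1,2) in simp)

text \<open>Division by a suitable scalar \<open>t\<close> brings \<open>A\<close> within distance
  less than 1 of the identity, where the fixed point argument applies; the root found there is
  rescaled by \<open>sqrt t\<close>.\<close>

lemma op_sqrt_coercive:
  fixes A :: "'a::complex_hilbert \<Rightarrow>\<^sub>L 'a"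
  assumes A: "positive_op A" and c: "0 < c" "\<And>x. c * (norm x)\<^sup>2 \<le> Re (cinner (blinfun_apply A x) x)"
  shows "positive_op (op_sqrt A)" "op_sqrt A o\<^sub>L op_sqrt A = A"
proof -
  have Ab: "A \<in> bounded_ops" using A by (simp add: positive_op_def)
  \<comment> \<open>The estimate below has the factor
    \<open>1 - 2 * c / t + (norm A)\<^sup>2 / t\<^sup>2\<close>, which
    \<open>t = (norm A)\<^sup>2 / c\<close> would minimise. The added \<open>c\<^sup>2\<close> keeps
    \<open>t\<close> positive and \<open>u \<le> 1\<close> on the zero space as well.\<close>
  define t where "t = ((norm A)\<^sup>2 + c\<^sup>2) / c"
  have t: "0 < t" using c by (simp add: t_def add_nonneg_pos)
  define u where "u = c / t"
  have u: "0 < u" "u \<le> 1" "(norm A)\<^sup>2 / t\<^sup>2 \<le> u"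
  proof -
    show "0 < u" using c t by (simp add: u_def)
    have u_eq: "u = c\<^sup>2 / ((norm A)\<^sup>2 + c\<^sup>2)"
      using c by (simp add: u_def t_def power2_eq_square)
    then show u1: "u \<le> 1" using c by (simp add: divide_le_eq_1 add_nonneg_pos)
    have "(norm A)\<^sup>2 \<le> (norm A)\<^sup>2 + c\<^sup>2" by simp
    also have "\<dots> = u * t\<^sup>2"
      using c t by (simp add: u_def power2_eq_square) (simp add: t_def power2_eq_square)
    finally show "(norm A)\<^sup>2 / t\<^sup>2 \<le> u" using t by (simp add: divide_le_eq)
  qed
  define B where "B = id_blinfun - (1 / t) *\<^sub>R A"
  have B: "B \<in> bounded_ops" using Ab by (simp add: B_def scaleR_scaleC)
  have Bsa: "cinner (blinfun_apply B x) y = cinner x (blinfun_apply B y)" for x y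
    using positive_op_self_adjoint[OF A]
    by (simp add: B_def blinfun.diff_left cinner_simps scaleR_scaleC scaleC_blinfun.rep_eq)
  have "norm B \<le> sqrt (1 - u)"
  proof (rule norm_blinfun_bound)
    fix x
    have "(norm (blinfun_apply B x))\<^sup>2
        = (norm x)\<^sup>2 - 2 / t * inner (blinfun_apply A x) x + (norm (blinfun_apply A x))\<^sup>2 / t\<^sup>2"
      unfolding power2_norm_eq_inner
      by (simp add: B_def blinfun.diff_left blinfun.scaleR_left inner_simps inner_commute
          power2_eq_square)
    also have "\<dots> \<le> (norm x)\<^sup>2 - 2 / t * (c * (norm x)\<^sup>2) + (norm A * norm x)\<^sup>2 / t\<^sup>2"
      using c(2)[of x] t unfolding Re_cinner
      by (intro add_mono diff_mono mult_left_mono divide_right_mono power_mono norm_blinfun) auto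
    also have "\<dots> = (1 - 2 * u + (norm A)\<^sup>2 / t\<^sup>2) * (norm x)\<^sup>2"
      by (simp add: u_def power_mult_distrib algebra_simps)
    also have "\<dots> \<le> (1 - u) * (norm x)\<^sup>2"
      using u by (intro mult_right_mono) auto
    also have "\<dots> = (sqrt (1 - u) * norm x)\<^sup>2"
      using u by (simp add: power_mult_distrib)
    finally show "norm (blinfun_apply B x) \<le> sqrt (1 - u) * norm x"
      using u by (auto intro: power2_le_imp_le)
  qed (use u in simp)
  moreover have "sqrt (1 - u) < 1" using u by simp
  ultimately obtain Y r where Y: "Y \<in> bounded_ops"
      "\<And>x y. cinner (blinfun_apply Y x) y = cinner x (blinfun_apply Y y)"
      "norm Y \<le> r" "r < 1" "(id_blinfun - Y) o\<^sub>L (id_blinfun - Y) = id_blinfun - B"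
      "\<And>C. C o\<^sub>L B = B o\<^sub>L C \<Longrightarrow> C o\<^sub>L Y = Y o\<^sub>L C"
    using sqrt_near_id[OF B Bsa] by metis
  \<comment> \<open>A square root of \<open>A\<close>, since
    \<open>A = t *\<^sub>R (id_blinfun - B)\<close> and \<open>id_blinfun - B\<close> is the square
    of \<open>id_blinfun - Y\<close>.\<close>
  define S where "S = sqrt t *\<^sub>R (id_blinfun - Y)"
  have S_eq: "cinner (blinfun_apply S x) x = of_real (sqrt t * ((norm x)\<^sup>2 - inner (blinfun_apply Y x) x))" for x
  proof -
    have "cnj (cinner (blinfun_apply Y x) x) = cinner (blinfun_apply Y x) x"
      using Y(2)[of x x] by (simp add: cinner_commute[of x])
    then have "cinner (blinfun_apply Y x) x = of_real (inner (blinfun_apply Y x) x)"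
      by (metis Re_cinner Reals_cnj_iff of_real_Re)
    then show ?thesis
      by (simp add: S_def blinfun.diff_left scaleC_blinfun.rep_eq cinner_simps scaleR_scaleC cinner_self)
  qed
  have S_ge: "sqrt t * (1 - r) * (norm x)\<^sup>2 \<le> sqrt t * ((norm x)\<^sup>2 - inner (blinfun_apply Y x) x)" for x
  proof -
    have "inner (blinfun_apply Y x) x \<le> norm (blinfun_apply Y x) * norm x" by (rule norm_cauchy_schwarz)
    also have "\<dots> \<le> (norm Y * norm x) * norm x" by (intro mult_right_mono norm_blinfun) simp
    also have "\<dots> \<le> (r * norm x) * norm x" by (intro mult_right_mono Y(3)) simp_all
    finally have "(1 - r) * (norm x)\<^sup>2 \<le> (norm x)\<^sup>2 - inner (blinfun_apply Y x) x"
      by (simp add: power2_eq_square algebra_simps)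
    then show ?thesis using t by (simp add: mult.assoc)
  qed
  have pos: "positive_op S"
    unfolding positive_op_def
  proof (intro conjI allI)
    show "S \<in> bounded_ops" using Y by (simp add: S_def scaleR_scaleC)
    fix x :: 'a
    have "0 \<le> sqrt t * (1 - r) * (norm x)\<^sup>2" using t Y by simp
    also note S_ge[of x]
    finally show "cinner (blinfun_apply S x) x \<in> \<real>\<^sub>\<ge>\<^sub>0"
      unfolding S_eq by (simp only: nonneg_Reals_of_real_iff)
  qed
  have SS: "S o\<^sub>L S = A"
    using t by (simp add: S_def blinfun_comp.scaleR_left blinfun_comp.scaleR_right Y(5) B_def)
  have "op_sqrt A = S"
  proof (rule op_sqrt_unique[OF pos SS])
    show "C o\<^sub>L S = S o\<^sub>L C" if "C o\<^sub>L A = A o\<^sub>L C" for C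
    proof -
      have "C o\<^sub>L B = B o\<^sub>L C" using that
        by (simp add: B_def blinfun_comp.diff_left blinfun_comp.diff_right
            blinfun_comp.scaleR_left blinfun_comp.scaleR_right)
      from Y(6)[OF this] show ?thesis
        by (simp add: S_def blinfun_comp.diff_left blinfun_comp.diff_right
            blinfun_comp.scaleR_left blinfun_comp.scaleR_right)
    qed
    show "0 < sqrt t * (1 - r)" using t Y by simp
    show "sqrt t * (1 - r) * (norm x)\<^sup>2 \<le> Re (cinner (blinfun_apply S x) x)" for x
      unfolding S_eq using S_ge[of x] by simp
  qed
  with pos SS show "positive_op (op_sqrt A)" "op_sqrt A o\<^sub>L op_sqrt A = A" by simp_all
qed

section \<open>Gram operators and their inverse square roots\<close>

lemma op_invertible_gram_bound:
  fixes G :: "'a::complex_hilbert \<Rightarrow>\<^sub>L 'b::complex_hilbert"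
  assumes inv: "op_invertible (op_adj G o\<^sub>L G)"
  obtains c where "0 < c" "\<And>x. c * (norm x)\<^sup>2 \<le> (norm (blinfun_apply G x))\<^sup>2"
proof -
  \<comment> \<open>\<open>M\<close> bounds the norm of the left inverse
    \<open>op_inverse (op_adj G o\<^sub>L G) o\<^sub>L op_adj G\<close> of \<open>G\<close>, so that
    \<open>norm x\<close> is at most \<open>M\<close> times the norm of its image. The summand 1
    keeps \<open>M\<close> positive on the zero space.\<close>
  define M where "M = norm (op_inverse (op_adj G o\<^sub>L G)) * norm (op_adj G) + 1"
  have M: "0 < M" by (simp add: M_def add_nonneg_pos)
  have "1 / M\<^sup>2 * (norm x)\<^sup>2 \<le> (norm (blinfun_apply G x))\<^sup>2" for x
  proof -
    have "norm x = norm (blinfun_apply (op_inverse (op_adj G o\<^sub>L G) o\<^sub>L op_adj G) (blinfun_apply G x))"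
      using op_inverse_apply_left[OF inv, of x] by simp
    also have "\<dots> \<le> norm (op_inverse (op_adj G o\<^sub>L G) o\<^sub>L op_adj G) * norm (blinfun_apply G x)"
      by (rule norm_blinfun)
    also have "\<dots> \<le> M * norm (blinfun_apply G x)"
      using norm_blinfun_compose[of "op_inverse (op_adj G o\<^sub>L G)" "op_adj G"]
      by (intro mult_right_mono) (auto simp: M_def)
    finally have "(norm x)\<^sup>2 \<le> (M * norm (blinfun_apply G x))\<^sup>2" by (rule power_mono) simp
    then show ?thesis using M by (simp add: power_mult_distrib divide_le_eq mult.commute)
  qed
  then show thesis using that[of "1 / M\<^sup>2"] M by simp
qed

lemma cinner_gram:
  "G \<in> bounded_ops \<Longrightarrow>
    cinner (blinfun_apply (op_adj G o\<^sub>L G) x) x = of_real ((norm (blinfun_apply G x))\<^sup>2)"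
  by (simp add: cinner_op_adj_left cinner_self del: of_real_power)

lemma op_sqrt_gram:
  fixes G :: "'a::complex_hilbert \<Rightarrow>\<^sub>L 'b::complex_hilbert"
  assumes G: "G \<in> bounded_ops" and inv: "op_invertible (op_adj G o\<^sub>L G)"
  defines "S \<equiv> op_sqrt (op_adj G o\<^sub>L G)"
  shows "S \<in> bounded_ops" "op_adj S = S" "op_invertible S"
    "op_inverse S o\<^sub>L op_inverse S = op_inverse (op_adj G o\<^sub>L G)"
proof -
  define A where "A = op_adj G o\<^sub>L G"
  obtain c where c: "0 < c" "\<And>x. c * (norm x)\<^sup>2 \<le> (norm (blinfun_apply G x))\<^sup>2"
    using op_invertible_gram_bound[OF inv] by metis
  have "positive_op A"
    unfolding positive_op_def A_def cinner_gram[OF G] using G by (simp del: of_real_power)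
  moreover have "c * (norm x)\<^sup>2 \<le> Re (cinner (blinfun_apply A x) x)" for x
    unfolding A_def cinner_gram[OF G] using c(2) by simp
  ultimately have S: "positive_op S" "S o\<^sub>L S = A"
    unfolding S_def A_def[symmetric] using op_sqrt_coercive[of A c] c(1) by blast+
  show Sb: "S \<in> bounded_ops" using S by (simp add: positive_op_def)
  show "op_adj S = S" by (rule op_adj_eqI) (rule positive_op_self_adjoint[OF S(1)])
  have invA: "op_invertible A" using inv by (simp add: A_def)
  have 1: "S o\<^sub>L (S o\<^sub>L op_inverse A) = id_blinfun"
    using op_inverse_right[OF invA] by (simp add: S(2)[symmetric] blinfun_compose_assoc)
  have 2: "(op_inverse A o\<^sub>L S) o\<^sub>L S = id_blinfun"
    using op_inverse_left[OF invA] by (simp add: S(2)[symmetric] blinfun_compose_assoc)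
  \<comment> \<open>A left and a right inverse of \<open>S\<close> are at hand; inserting the
    identity between them shows that they coincide.\<close>
  have "op_inverse A o\<^sub>L S = (op_inverse A o\<^sub>L S) o\<^sub>L (S o\<^sub>L (S o\<^sub>L op_inverse A))" by (simp add: 1)
  also have "\<dots> = ((op_inverse A o\<^sub>L S) o\<^sub>L S) o\<^sub>L (S o\<^sub>L op_inverse A)" by (simp add: blinfun_compose_assoc)
  also have "\<dots> = S o\<^sub>L op_inverse A" by (simp only: 2 blinfun_compose_id)
  finally show invS: "op_invertible S" using op_inverse_eqI(2)[OF 1] 2 by simp
  have "op_inverse A = op_inverse S o\<^sub>L op_inverse S"
    by (rule op_inverse_eqI(1); rule blinfun_eqI)
      (simp_all add: S(2)[symmetric] op_inverse_apply_left op_inverse_apply_right invS)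
  then show "op_inverse S o\<^sub>L op_inverse S = op_inverse (op_adj G o\<^sub>L G)" by (simp add: A_def)
qed

section \<open>Vector-valued holomorphic and meromorphic functions\<close>

text \<open>Difference quotients pass directly through adjoints and inverses. \<open>op_adj\<close>
  is determined only on complex-linear operators, so derivative rules for bounded linear maps do not
  apply to it.\<close>

lemma scaleC_derivative_iff:
  fixes f :: "complex \<Rightarrow> 'a::complex_normed_vector"
  shows "(f has_derivative (\<lambda>h. h *\<^sub>C D)) (at z within S) \<longleftrightarrow>
    ((\<lambda>w. inverse (w - z) *\<^sub>C (f w - f z)) \<longlongrightarrow> D) (at z within S)"
proof -
  have "bounded_linear (\<lambda>h. h *\<^sub>C D)"
    by (rule bounded_bilinear.bounded_linear_left[OF bounded_bilinear_scaleC])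
  then have "(f has_derivative (\<lambda>h. h *\<^sub>C D)) (at z within S) \<longleftrightarrow>
      ((\<lambda>w. norm (f w - f z - (w - z) *\<^sub>C D) / norm (w - z)) \<longlongrightarrow> 0) (at z within S)"
    by (simp add: has_derivative_iff_norm)
  also have "\<dots> \<longleftrightarrow>
      ((\<lambda>w. norm (inverse (w - z) *\<^sub>C (f w - f z) - D)) \<longlongrightarrow> 0) (at z within S)"
  proof (rule filterlim_cong[OF refl refl])
    have "norm (f w - f z - (w - z) *\<^sub>C D) / norm (w - z) = norm (inverse (w - z) *\<^sub>C (f w - f z) - D)"
      if "w \<noteq> z" for w
    proof -
      have "inverse (w - z) *\<^sub>C (f w - f z) - D = inverse (w - z) *\<^sub>C (f w - f z - (w - z) *\<^sub>C D)"
        using that by (simp add: complex_vector.scale_right_diff_distrib[of _ _ "(w - z) *\<^sub>C D"] scaleC_scaleC)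
      then show ?thesis by (simp add: norm_scaleC norm_inverse divide_inverse mult.commute)
    qed
    then show "\<forall>\<^sub>F w in at z within S. norm (f w - f z - (w - z) *\<^sub>C D) / norm (w - z)
        = norm (inverse (w - z) *\<^sub>C (f w - f z) - D)"
      by (auto simp: eventually_at_filter)
  qed
  also have "\<dots> \<longleftrightarrow> ((\<lambda>w. inverse (w - z) *\<^sub>C (f w - f z)) \<longlongrightarrow> D) (at z within S)"
    by (simp only: tendsto_norm_zero_iff LIM_zero_iff)
  finally show ?thesis .
qed

lemma vec_holomorphic_on_iff:
  "vec_holomorphic_on f S \<longleftrightarrow>
    (\<forall>z\<in>S. \<exists>D. ((\<lambda>w. inverse (w - z) *\<^sub>C (f w - f z)) \<longlongrightarrow> D) (at z within S))"
  unfolding vec_holomorphic_on_def scaleC_derivative_iff ..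

lemma vec_holomorphic_on_subset: "vec_holomorphic_on f S \<Longrightarrow> R \<subseteq> S \<Longrightarrow> vec_holomorphic_on f R"
  unfolding vec_holomorphic_on_def by (meson has_derivative_subset subset_iff)

lemma vec_holomorphic_on_transform:
  assumes "vec_holomorphic_on f S" "\<And>z. z \<in> S \<Longrightarrow> g z = f z"
  shows "vec_holomorphic_on g S"
  unfolding vec_holomorphic_on_def
proof
  fix z assume z: "z \<in> S"
  with assms(1) obtain D where "(f has_derivative (\<lambda>h. h *\<^sub>C D)) (at z within S)"
    unfolding vec_holomorphic_on_def by blast
  from has_derivative_transform[OF z assms(2) this]
  show "\<exists>D. (g has_derivative (\<lambda>h. h *\<^sub>C D)) (at z within S)" by blast
qed

lemma vec_holomorphic_on_continuous_on: "vec_holomorphic_on f S \<Longrightarrow> continuous_on S f"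
  unfolding vec_holomorphic_on_def continuous_on_eq_continuous_within
  using has_derivative_continuous by blast

lemma vec_holomorphic_on_const: "vec_holomorphic_on (\<lambda>z. c) S"
  unfolding vec_holomorphic_on_iff by (auto intro: tendsto_const)

lemma vec_holomorphic_on_add:
  assumes "vec_holomorphic_on f S" "vec_holomorphic_on g S"
  shows "vec_holomorphic_on (\<lambda>z. f z + g z) S"
  unfolding vec_holomorphic_on_def
proof
  fix z assume "z \<in> S"
  with assms obtain D E where D: "(f has_derivative (\<lambda>h. h *\<^sub>C D)) (at z within S)"
    and E: "(g has_derivative (\<lambda>h. h *\<^sub>C E)) (at z within S)"
    unfolding vec_holomorphic_on_def by blast
  show "\<exists>D. ((\<lambda>z. f z + g z) has_derivative (\<lambda>h. h *\<^sub>C D)) (at z within S)"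
    using has_derivative_add[OF D E] by (intro exI[of _ "D + E"]) (simp add: scaleC_add_right)
qed

lemma vec_holomorphic_on_sum:
  assumes "\<And>i. i \<in> I \<Longrightarrow> vec_holomorphic_on (f i) S"
  shows "vec_holomorphic_on (\<lambda>z. \<Sum>i\<in>I. f i z) S"
  using assms
  by (induction I rule: infinite_finite_induct)
    (simp_all add: vec_holomorphic_on_const vec_holomorphic_on_add)

text \<open>Homogeneity in the second slot is demanded only at the values \<open>f z\<close>,
  because \<open>A o\<^sub>L (c *\<^sub>C B) = c *\<^sub>C (A o\<^sub>L B)\<close> can fail for a
  merely real-linear \<open>A\<close>.\<close>

lemma vec_holomorphic_on_bilinear:
  assumes "bounded_bilinear bil" "vec_holomorphic_on f S" "vec_holomorphic_on g S"
    and left: "\<And>c x y. bil (c *\<^sub>C x) y = c *\<^sub>C bil x y"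
    and right: "\<And>c z y. z \<in> S \<Longrightarrow> bil (f z) (c *\<^sub>C y) = c *\<^sub>C bil (f z) y"
  shows "vec_holomorphic_on (\<lambda>z. bil (f z) (g z)) S"
  unfolding vec_holomorphic_on_def
proof
  fix z assume z: "z \<in> S"
  with assms obtain D E where D: "(f has_derivative (\<lambda>h. h *\<^sub>C D)) (at z within S)"
    and E: "(g has_derivative (\<lambda>h. h *\<^sub>C E)) (at z within S)"
    unfolding vec_holomorphic_on_def by blast
  show "\<exists>D. ((\<lambda>z. bil (f z) (g z)) has_derivative (\<lambda>h. h *\<^sub>C D)) (at z within S)"
    using bounded_bilinear.FDERIV[OF assms(1) D E]
    by (intro exI[of _ "bil (f z) E + bil D (g z)"])
      (simp add: left right[OF z] scaleC_add_right)
qed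

lemma vec_holomorphic_on_scaleC:
  assumes "f holomorphic_on S" "vec_holomorphic_on g S"
  shows "vec_holomorphic_on (\<lambda>z. f z *\<^sub>C g z) S"
  by (rule vec_holomorphic_on_bilinear[OF bounded_bilinear_scaleC])
    (use assms in \<open>simp_all add: vec_holomorphic_on_complex scaleC_complex_def scaleC_scaleC mult.commute\<close>)

lemma vec_holomorphic_on_compose:
  assumes "vec_holomorphic_on f S" "vec_holomorphic_on g S" "\<And>z. z \<in> S \<Longrightarrow> f z \<in> bounded_ops"
  shows "vec_holomorphic_on (\<lambda>z. f z o\<^sub>L g z) S"
  by (rule vec_holomorphic_on_bilinear[OF bounded_bilinear_blinfun_compose assms(1,2)])
    (simp_all add: blinfun_compose_scaleC_left blinfun_compose_scaleC_right assms(3))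

lemma vec_coholomorphic_on_iff:
  fixes f :: "complex \<Rightarrow> 'a::complex_normed_vector"
  assumes "vec_coholomorphic_on f S" "z \<in> S"
  shows "\<exists>D. ((\<lambda>w. inverse (cnj (w - z)) *\<^sub>C (f w - f z)) \<longlongrightarrow> D) (at z within S)"
proof -
  obtain D where D: "((\<lambda>w. inverse (w - cnj z) *\<^sub>C (f (cnj w) - f z)) \<longlongrightarrow> D) (at (cnj z) within cnj ` S)"
    using assms unfolding vec_coholomorphic_on_def vec_holomorphic_on_iff by force
  have "filterlim cnj (at (cnj z) within cnj ` S) (at z within S)"
    unfolding filterlim_at by (auto simp: eventually_at_filter intro: tendsto_intros)
  from filterlim_compose[OF D this] show ?thesis by auto
qed

lemma vec_coholomorphic_on_continuous_on:
  assumes "vec_coholomorphic_on f S"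
  shows "continuous_on S f"
proof -
  have "continuous_on (cnj ` S) (\<lambda>z. f (cnj z))"
    using assms unfolding vec_coholomorphic_on_def by (rule vec_holomorphic_on_continuous_on)
  then have "continuous_on S ((\<lambda>z. f (cnj z)) \<circ> cnj)"
    by (intro continuous_on_compose continuous_intros)
  then show ?thesis by (simp add: o_def)
qed

text \<open>On complex-linear operators the adjoint is additive and isometric, so distances to the
  limit are preserved.\<close>

lemma tendsto_op_adj:
  assumes "(f \<longlongrightarrow> A) F" "\<forall>\<^sub>F x in F. f x \<in> bounded_ops" "A \<in> bounded_ops"
  shows "((\<lambda>x. op_adj (f x)) \<longlongrightarrow> op_adj A) F"
proof -
  have "((\<lambda>x. norm (f x - A)) \<longlongrightarrow> 0) F"
    using assms(1) by (simp add: LIM_zero tendsto_norm_zero)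
  moreover have "\<forall>\<^sub>F x in F. norm (f x - A) = norm (op_adj (f x) - op_adj A)"
    using assms(2)
  proof eventually_elim
    case (elim x)
    then show ?case
      using norm_op_adj[of "f x - A"] assms(3) by (simp add: op_adj_diff)
  qed
  ultimately have "((\<lambda>x. norm (op_adj (f x) - op_adj A)) \<longlongrightarrow> 0) F"
    using tendsto_cong by fast
  then show ?thesis by (simp only: tendsto_norm_zero_iff LIM_zero_iff)
qed

text \<open>Conjugate linearity of the adjoint turns the quotient by \<open>cnj (w - z)\<close> into
  the quotient by \<open>w - z\<close>.\<close>

lemma vec_holomorphic_on_op_adj:
  assumes hol: "vec_coholomorphic_on f S" and S: "open S" and f: "\<And>z. z \<in> S \<Longrightarrow> f z \<in> bounded_ops"
  shows "vec_holomorphic_on (\<lambda>z. op_adj (f z)) S"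
  unfolding vec_holomorphic_on_iff
proof
  fix z assume z: "z \<in> S"
  obtain D where D: "((\<lambda>w. inverse (cnj (w - z)) *\<^sub>C (f w - f z)) \<longlongrightarrow> D) (at z within S)"
    using vec_coholomorphic_on_iff[OF hol z] by blast
  have ev: "\<forall>\<^sub>F w in at z within S. w \<in> S" by (simp add: eventually_at_filter)
  then have b: "\<forall>\<^sub>F w in at z within S. inverse (cnj (w - z)) *\<^sub>C (f w - f z) \<in> bounded_ops"
    by eventually_elim (simp add: f z)
  \<comment> \<open>A limit of complex-linear quotients along a nontrivial filter is complex-linear,
    so \<open>D\<close> has an adjoint.\<close>
  have "at z within S \<noteq> bot" unfolding at_within_open[OF z S] by simp
  from Lim_in_closed_set[OF closed_bounded_ops b this D] have "D \<in> bounded_ops" .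
  from tendsto_op_adj[OF D b this]
  have "((\<lambda>w. inverse (w - z) *\<^sub>C (op_adj (f w) - op_adj (f z))) \<longlongrightarrow> op_adj D) (at z within S)"
  proof (rule Lim_transform_eventually)
    show "\<forall>\<^sub>F w in at z within S. op_adj (inverse (cnj (w - z)) *\<^sub>C (f w - f z)) =
        inverse (w - z) *\<^sub>C (op_adj (f w) - op_adj (f z))"
      using ev by eventually_elim (simp add: f z op_adj_scaleC op_adj_diff)
  qed
  then show "\<exists>D. ((\<lambda>w. inverse (w - z) *\<^sub>C (op_adj (f w) - op_adj (f z))) \<longlongrightarrow> D) (at z within S)" ..
qed

lemma op_inverse_diff:
  assumes "op_invertible A" "op_invertible B"
  shows "op_inverse A - op_inverse B = - (op_inverse A o\<^sub>L ((A - B) o\<^sub>L op_inverse B))"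
  by (rule blinfun_eqI)
    (simp add: blinfun.diff_left blinfun.diff_right blinfun.minus_left op_inverse_apply_left
      op_inverse_apply_right assms)

lemma tendsto_op_inverse:
  fixes f :: "'b \<Rightarrow> ('a::real_normed_vector \<Rightarrow>\<^sub>L 'a)"
  assumes lim: "(f \<longlongrightarrow> A) F" and ev: "\<forall>\<^sub>F x in F. op_invertible (f x)" and A: "op_invertible A"
  shows "((\<lambda>x. op_inverse (f x)) \<longlongrightarrow> op_inverse A) F"
proof -
  define M where "M = norm (op_inverse A)"
  have diff: "norm (op_inverse X - op_inverse A) \<le> norm (op_inverse X) * (norm (X - A) * M)"
    if X: "op_invertible X" for X :: "'a \<Rightarrow>\<^sub>L 'a"
  proof -
    have "norm (op_inverse X - op_inverse A) \<le> norm (op_inverse X) * norm ((X - A) o\<^sub>L op_inverse A)"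
      unfolding op_inverse_diff[OF X A] norm_minus_cancel by (rule norm_blinfun_compose)
    also have "\<dots> \<le> norm (op_inverse X) * (norm (X - A) * M)"
      unfolding M_def by (intro mult_left_mono norm_blinfun_compose) simp
    finally show ?thesis .
  qed
  have lim0: "((\<lambda>x. norm (f x - A) * M) \<longlongrightarrow> 0) F"
    using tendsto_mult[OF tendsto_norm_zero[OF LIM_zero[OF lim]] tendsto_const[of M]] by simp
  \<comment> \<open>Below 1/2 the estimate \<open>diff\<close> can be solved for
    \<open>norm (op_inverse (f x))\<close>, which gives the uniform bound
    \<open>2 * M\<close>.\<close>
  then have "\<forall>\<^sub>F x in F. norm (f x - A) * M < 1/2" by (rule order_tendstoD) simp
  with ev have "\<forall>\<^sub>F x in F. norm (op_inverse (f x) - op_inverse A) \<le> 2 * M * (norm (f x - A) * M)"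
  proof eventually_elim
    case (elim x)
    have "norm (op_inverse (f x)) \<le> M + norm (op_inverse (f x) - op_inverse A)"
      unfolding M_def by (metis add.commute diff_add_cancel norm_triangle_ineq)
    also have "\<dots> \<le> M + norm (op_inverse (f x)) * (1/2)"
      using diff[OF elim(1)] mult_left_mono[of "norm (f x - A) * M" "1/2" "norm (op_inverse (f x))"] elim(2)
      by simp
    finally have "norm (op_inverse (f x)) \<le> 2 * M" by simp
    then have "norm (op_inverse (f x)) * (norm (f x - A) * M) \<le> 2 * M * (norm (f x - A) * M)"
      by (rule mult_right_mono) (simp add: M_def)
    with diff[OF elim(1)] show ?case by linarith
  qed
  moreover have "((\<lambda>x. 2 * M * (norm (f x - A) * M)) \<longlongrightarrow> 0) F"
    using tendsto_mult[OF tendsto_const[of "2 * M"] lim0] by simp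
  ultimately have "((\<lambda>x. op_inverse (f x) - op_inverse A) \<longlongrightarrow> 0) F"
    by (rule Lim_null_comparison)
  then show ?thesis by (simp add: LIM_zero_iff)
qed

lemma vec_holomorphic_on_op_inverse:
  fixes f :: "complex \<Rightarrow> ('a::complex_normed_vector \<Rightarrow>\<^sub>L 'a)"
  assumes hol: "vec_holomorphic_on f S"
    and inv: "\<And>z. z \<in> S \<Longrightarrow> op_invertible (f z)" and f: "\<And>z. z \<in> S \<Longrightarrow> op_inverse (f z) \<in> bounded_ops"
  shows "vec_holomorphic_on (\<lambda>z. op_inverse (f z)) S"
  unfolding vec_holomorphic_on_iff
proof
  fix z assume z: "z \<in> S"
  obtain D where D: "((\<lambda>w. inverse (w - z) *\<^sub>C (f w - f z)) \<longlongrightarrow> D) (at z within S)"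
    using hol z unfolding vec_holomorphic_on_iff by blast
  have ev: "\<forall>\<^sub>F w in at z within S. w \<in> S" by (simp add: eventually_at_filter)
  have "(f \<longlongrightarrow> f z) (at z within S)"
    using vec_holomorphic_on_continuous_on[OF hol] z by (simp add: continuous_on)
  then have X: "((\<lambda>w. op_inverse (f w)) \<longlongrightarrow> op_inverse (f z)) (at z within S)"
    using ev inv z by (intro tendsto_op_inverse) (auto elim: eventually_mono)
  have "((\<lambda>w. - (op_inverse (f w) o\<^sub>L ((inverse (w - z) *\<^sub>C (f w - f z)) o\<^sub>L op_inverse (f z))))
      \<longlongrightarrow> - (op_inverse (f z) o\<^sub>L (D o\<^sub>L op_inverse (f z)))) (at z within S)"
    by (intro tendsto_minus blinfun_comp.tendsto X D tendsto_const)
  then have "((\<lambda>w. inverse (w - z) *\<^sub>C (op_inverse (f w) - op_inverse (f z)))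
      \<longlongrightarrow> - (op_inverse (f z) o\<^sub>L (D o\<^sub>L op_inverse (f z)))) (at z within S)"
  proof (rule Lim_transform_eventually)
    show "\<forall>\<^sub>F w in at z within S.
        - (op_inverse (f w) o\<^sub>L ((inverse (w - z) *\<^sub>C (f w - f z)) o\<^sub>L op_inverse (f z))) =
        inverse (w - z) *\<^sub>C (op_inverse (f w) - op_inverse (f z))"
      using ev by eventually_elim
        (simp add: op_inverse_diff inv z blinfun_compose_scaleC_left blinfun_compose_scaleC_right f
          complex_vector.scale_minus_right)
  qed
  then show "\<exists>D. ((\<lambda>w. inverse (w - z) *\<^sub>C (op_inverse (f w) - op_inverse (f z))) \<longlongrightarrow> D) (at z within S)" ..
qed

section \<open>Meromorphic operator functions\<close>

lemma vec_meromorphic_on_Un: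
  "vec_meromorphic_on f (R \<union> S) \<longleftrightarrow> vec_meromorphic_on f R \<and> vec_meromorphic_on f S"
  unfolding vec_meromorphic_on_def by blast

lemma vec_meromorphic_on_subset: "vec_meromorphic_on f S \<Longrightarrow> R \<subseteq> S \<Longrightarrow> vec_meromorphic_on f R"
  unfolding vec_meromorphic_on_def by blast

lemma vec_holomorphic_on_imp_meromorphic_on:
  assumes "vec_holomorphic_on f S" "open S"
  shows "vec_meromorphic_on f S"
  unfolding vec_meromorphic_on_def
proof
  fix z assume "z \<in> S"
  then obtain r where r: "0 < r" "ball z r \<subseteq> S" using assms(2) openE by blast
  with assms show "\<exists>m g r. 0 < r \<and> vec_holomorphic_on g (ball z r) \<and>
      (\<forall>w\<in>ball z r - {z}. (w - z) ^ m *\<^sub>C f w = g w)"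
    by (intro exI[of _ 0] exI[of _ f] exI[of _ r]) (auto intro: vec_holomorphic_on_subset)
qed

lemma vec_meromorphic_on_scaleC:
  assumes "vec_meromorphic_on f S" "vec_meromorphic_on g S"
  shows "vec_meromorphic_on (\<lambda>z. f z *\<^sub>C g z) S"
  unfolding vec_meromorphic_on_def
proof
  fix z assume z: "z \<in> S"
  obtain m F r where F: "0 < r" "vec_holomorphic_on F (ball z r)"
      "\<And>w. w\<in>ball z r - {z} \<Longrightarrow> (w - z) ^ m *\<^sub>C f w = F w"
    using assms(1) z unfolding vec_meromorphic_on_def by blast
  obtain n G q where G: "0 < q" "vec_holomorphic_on G (ball z q)"
      "\<And>w. w\<in>ball z q - {z} \<Longrightarrow> (w - z) ^ n *\<^sub>C g w = G w"
    using assms(2) z unfolding vec_meromorphic_on_def by blast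
  have "vec_holomorphic_on (\<lambda>w. F w *\<^sub>C G w) (ball z (min r q))"
    using F(2) G(2)
    by (intro vec_holomorphic_on_scaleC)
      (auto simp: vec_holomorphic_on_complex[symmetric] intro: vec_holomorphic_on_subset)
  moreover have "(w - z) ^ (m + n) *\<^sub>C (f w *\<^sub>C g w) = F w *\<^sub>C G w" if "w \<in> ball z (min r q) - {z}" for w
    using that F(3)[of w, symmetric] G(3)[of w, symmetric]
    by (simp add: scaleC_scaleC scaleC_complex_def power_add mult_ac)
  ultimately show "\<exists>m h r. 0 < r \<and> vec_holomorphic_on h (ball z r) \<and>
      (\<forall>w\<in>ball z r - {z}. (w - z) ^ m *\<^sub>C (f w *\<^sub>C g w) = h w)"
    using F(1) G(1)
    by (intro exI[of _ "m + n"] exI[of _ "\<lambda>w. F w *\<^sub>C G w"] exI[of _ "min r q"]) auto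
qed

text \<open>The power of \<open>w - z\<close> that belongs to \<open>g\<close> has to be moved
  through the left factor, which must therefore be complex-linear. Holomorphy of the product asks
  the same of the regularised factor \<open>F\<close>, also at the centre.\<close>

lemma vec_meromorphic_on_compose:
  assumes "vec_meromorphic_on f S" "vec_meromorphic_on g S" and f: "\<And>z. z \<in> S \<Longrightarrow> f z \<in> bounded_ops"
    and S: "open S"
  shows "vec_meromorphic_on (\<lambda>z. f z o\<^sub>L g z) S"
  unfolding vec_meromorphic_on_def
proof
  fix z assume z: "z \<in> S"
  obtain m F r' where F': "0 < r'" "vec_holomorphic_on F (ball z r')"
      "\<And>w. w\<in>ball z r' - {z} \<Longrightarrow> (w - z) ^ m *\<^sub>C f w = F w"
    using assms(1) z unfolding vec_meromorphic_on_def by blast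
  \<comment> \<open>The disc of the expansion may leave \<open>S\<close>, and complex linearity of
    the values of \<open>f\<close> is given only on \<open>S\<close>.\<close>
  obtain s where s: "0 < s" "ball z s \<subseteq> S" using S z openE by blast
  define r where "r = min r' s"
  have F: "0 < r" "vec_holomorphic_on F (ball z r)"
      "\<And>w. w\<in>ball z r - {z} \<Longrightarrow> (w - z) ^ m *\<^sub>C f w = F w"
    using F' s(1) by (auto simp: r_def intro: vec_holomorphic_on_subset)
  have f: "f w \<in> bounded_ops" if "w \<in> ball z r" for w
    using that s(2) by (intro f) (auto simp: r_def)
  obtain n G q where G: "0 < q" "vec_holomorphic_on G (ball z q)"
      "\<And>w. w\<in>ball z q - {z} \<Longrightarrow> (w - z) ^ n *\<^sub>C g w = G w"
    using assms(2) z unfolding vec_meromorphic_on_def by blast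
  have Fb: "F w \<in> bounded_ops" if "w \<in> ball z r - {z}" for w
    using f[of w] that F(3)[OF that, symmetric] by simp
  \<comment> \<open>The expansion does not tie \<open>F z\<close> to \<open>f z\<close>; its complex
    linearity is inherited from the nearby values of \<open>F\<close> by continuity.\<close>
  have "(F \<longlongrightarrow> F z) (at z)"
    using vec_holomorphic_on_continuous_on[OF F(2)] F(1)
    by (metis centre_in_ball continuous_on_eq_continuous_at isCont_def open_ball)
  moreover have "\<forall>\<^sub>F w in at z. F w \<in> bounded_ops"
    using eventually_at_ball'[OF F(1), of z UNIV] by (rule eventually_mono) (auto intro: Fb)
  ultimately have "F z \<in> bounded_ops"
    by (intro Lim_in_closed_set[OF closed_bounded_ops]) auto
  with Fb have Fb: "F w \<in> bounded_ops" if "w \<in> ball z r" for w using that by (cases "w = z") auto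
  have "vec_holomorphic_on (\<lambda>w. F w o\<^sub>L G w) (ball z (min r q))"
    using F(2) G(2) Fb
    by (intro vec_holomorphic_on_compose) (auto intro: vec_holomorphic_on_subset)
  moreover have "(w - z) ^ (m + n) *\<^sub>C (f w o\<^sub>L g w) = F w o\<^sub>L G w" if "w \<in> ball z (min r q) - {z}" for w
    using that F(3)[of w, symmetric] G(3)[of w, symmetric]
    by (simp add: scaleC_scaleC power_add blinfun_compose_scaleC_left blinfun_compose_scaleC_right f)
  ultimately show "\<exists>m h r. 0 < r \<and> vec_holomorphic_on h (ball z r) \<and>
      (\<forall>w\<in>ball z r - {z}. (w - z) ^ m *\<^sub>C (f w o\<^sub>L g w) = h w)"
    using F(1) G(1)
    by (intro exI[of _ "m + n"] exI[of _ "\<lambda>w. F w o\<^sub>L G w"] exI[of _ "min r q"]) auto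
qed

section \<open>Operators on finite-dimensional spaces\<close>

text \<open>The Leibniz expansion is a finite sum of products of entries.\<close>

lemma holomorphic_on_det:
  assumes carrier: "\<And>z. M z \<in> carrier_mat n n"
    and hol: "\<And>i j. i < n \<Longrightarrow> j < n \<Longrightarrow> (\<lambda>z. M z $$ (i, j)) holomorphic_on S"
  shows "(\<lambda>z. Determinant.det (M z)) holomorphic_on S"
proof -
  have "(\<lambda>z. \<Sum>p \<in> {p. p permutes {0..<n}}. signof p * (\<Prod>i = 0..<n. M z $$ (i, p i))) holomorphic_on S"
    using permutes_in_image by (intro holomorphic_intros hol) fastforce+
  then show ?thesis by (simp add: det_def'[OF carrier])
qed

lemma holomorphic_on_adj_mat:
  assumes carrier: "\<And>z. M z \<in> carrier_mat n n"
    and hol: "\<And>i j. i < n \<Longrightarrow> j < n \<Longrightarrow> (\<lambda>z. M z $$ (i, j)) holomorphic_on S"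
    and ij: "i < n" "j < n"
  shows "(\<lambda>z. adj_mat (M z) $$ (i, j)) holomorphic_on S"
proof -
  have "(\<lambda>z. (-1) ^ (j + i) * Determinant.det (mat_delete (M z) j i)) holomorphic_on S"
  proof (intro holomorphic_intros holomorphic_on_det)
    show del: "mat_delete (M z) j i \<in> carrier_mat (n - 1) (n - 1)" for z
      by (rule mat_delete_carrier[OF carrier])
    fix k l assume kl: "k < n - 1" "l < n - 1"
    \<comment> \<open>Indices of the minor skip row \<open>j\<close> and column \<open>i\<close>, so
      its entries are still entries of \<open>M z\<close>.\<close>
    have "(\<lambda>z. M z $$ (if k < j then k else Suc k, if l < i then l else Suc l)) holomorphic_on S"
      using kl by (intro hol) auto
    moreover have "mat_delete (M z) j i $$ (k, l) =
        M z $$ (if k < j then k else Suc k, if l < i then l else Suc l)" for z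
      using kl carrier[of z] by (simp add: mat_delete_def)
    ultimately show "(\<lambda>z. mat_delete (M z) j i $$ (k, l)) holomorphic_on S" by simp
  qed
  moreover have "adj_mat (M z) $$ (i, j) = (-1) ^ (j + i) * Determinant.det (mat_delete (M z) j i)" for z
    using carrier[of z] ij by (simp add: adj_mat_def cofactor_def)
  ultimately show ?thesis by simp
qed

section \<open>Matrices of operators in a finite orthonormal basis\<close>

definition rank_one :: "'k::complex_inner \<Rightarrow> 'k \<Rightarrow> 'k \<Rightarrow>\<^sub>L 'k"
  where "rank_one u v = Blinfun (\<lambda>x. cinner x v *\<^sub>C u)"

lemma rank_one_apply: "blinfun_apply (rank_one u v) x = cinner x v *\<^sub>C u"
proof -
  have "bounded_linear (\<lambda>x. cinner x v *\<^sub>C u)"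
    by (rule bounded_linear_compose[OF
          bounded_bilinear.bounded_linear_left[OF bounded_bilinear_scaleC]
          bounded_bilinear.bounded_linear_left[OF bounded_bilinear_cinner]])
  then show ?thesis by (simp add: rank_one_def bounded_linear_Blinfun_apply)
qed

locale finite_onb =
  fixes e :: "nat \<Rightarrow> 'k::complex_hilbert" and N :: nat
  assumes orthonormal: "i < N \<Longrightarrow> j < N \<Longrightarrow> cinner (e i) (e j) = (if i = j then 1 else 0)"
    and expansion: "x = (\<Sum>i<N. cinner x (e i) *\<^sub>C e i)"
begin

definition op_mat :: "('k \<Rightarrow>\<^sub>L 'k) \<Rightarrow> complex mat"
  where "op_mat A = mat N N (\<lambda>(i, j). cinner (blinfun_apply A (e j)) (e i))"

definition mat_op :: "complex mat \<Rightarrow> 'k \<Rightarrow>\<^sub>L 'k"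
  where "mat_op M = (\<Sum>i<N. \<Sum>j<N. M $$ (i, j) *\<^sub>C rank_one (e i) (e j))"

lemma op_mat_carrier [simp]: "op_mat A \<in> carrier_mat N N"
  by (simp add: op_mat_def)

lemma op_mat_compose:
  assumes "A \<in> bounded_ops"
  shows "op_mat (A o\<^sub>L B) = op_mat A * op_mat B"
proof (rule eq_matI)
  fix i j assume "i < dim_row (op_mat A * op_mat B)" "j < dim_col (op_mat A * op_mat B)"
  then have ij: "i < N" "j < N" by (simp_all add: op_mat_def)
  have "blinfun_apply A (blinfun_apply B (e j))
      = blinfun_apply A (\<Sum>k<N. cinner (blinfun_apply B (e j)) (e k) *\<^sub>C e k)"
    by (simp only: expansion[symmetric])
  also have "\<dots> = (\<Sum>k<N. cinner (blinfun_apply B (e j)) (e k) *\<^sub>C blinfun_apply A (e k))"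
    by (simp add: blinfun.sum_right bounded_opsD[OF assms])
  finally show "op_mat (A o\<^sub>L B) $$ (i, j) = (op_mat A * op_mat B) $$ (i, j)"
    using ij by (simp add: op_mat_def scalar_prod_def cinner_sum_left cinner_scaleC_left
        lessThan_atLeast0 mult.commute)
qed (simp_all add: op_mat_def)

lemma op_mat_inj:
  assumes A: "A \<in> bounded_ops" and B: "B \<in> bounded_ops" and eq: "op_mat A = op_mat B"
  shows "A = B"
proof (rule blinfun_eqI)
  fix x
  have "blinfun_apply A (e j) = blinfun_apply B (e j)" if j: "j < N" for j
  proof -
    have "cinner (blinfun_apply A (e j)) (e i) = cinner (blinfun_apply B (e j)) (e i)" if "i < N" for i
      using arg_cong[OF eq, of "\<lambda>M. M $$ (i, j)"] j that by (simp add: op_mat_def)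
    then have "(\<Sum>i<N. cinner (blinfun_apply A (e j)) (e i) *\<^sub>C e i)
        = (\<Sum>i<N. cinner (blinfun_apply B (e j)) (e i) *\<^sub>C e i)" by simp
    then show ?thesis by (simp only: expansion[symmetric])
  qed
  then have "(\<Sum>j<N. cinner x (e j) *\<^sub>C blinfun_apply A (e j)) = (\<Sum>j<N. cinner x (e j) *\<^sub>C blinfun_apply B (e j))"
    by simp
  then have "blinfun_apply A (\<Sum>j<N. cinner x (e j) *\<^sub>C e j) = blinfun_apply B (\<Sum>j<N. cinner x (e j) *\<^sub>C e j)"
    by (simp add: blinfun.sum_right bounded_opsD[OF A] bounded_opsD[OF B])
  then show "blinfun_apply A x = blinfun_apply B x" by (simp only: expansion[symmetric])
qed

lemma mat_op_apply:
  "blinfun_apply (mat_op M) x = (\<Sum>i<N. \<Sum>j<N. (M $$ (i, j) * cinner x (e j)) *\<^sub>C e i)"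
  by (simp add: mat_op_def blinfun.sum_left scaleC_blinfun.rep_eq rank_one_apply scaleC_scaleC)

lemma mat_op_bounded_ops [simp]: "mat_op M \<in> bounded_ops"
  by (rule bounded_opsI)
    (simp add: mat_op_apply cinner_scaleC_left complex_vector.scale_sum_right scaleC_scaleC mult_ac)

lemma op_mat_mat_op:
  assumes "M \<in> carrier_mat N N"
  shows "op_mat (mat_op M) = M"
proof (rule eq_matI)
  fix i j assume "i < dim_row M" "j < dim_col M"
  then have ij: "i < N" "j < N" using assms by auto
  have "blinfun_apply (mat_op M) (e j) = (\<Sum>k<N. M $$ (k, j) *\<^sub>C e k)"
    unfolding mat_op_apply
  proof (rule sum.cong[OF refl])
    fix k
    have "(\<Sum>l<N. (M $$ (k, l) * cinner (e j) (e l)) *\<^sub>C e k) = (\<Sum>l<N. if l = j then M $$ (k, j) *\<^sub>C e k else 0)"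
      using ij by (intro sum.cong) (auto simp: orthonormal)
    then show "(\<Sum>l<N. (M $$ (k, l) * cinner (e j) (e l)) *\<^sub>C e k) = M $$ (k, j) *\<^sub>C e k"
      using ij by simp
  qed
  then have "cinner (blinfun_apply (mat_op M) (e j)) (e i) = (\<Sum>k<N. M $$ (k, j) * cinner (e k) (e i))"
    by (simp add: cinner_sum_left cinner_scaleC_left)
  also have "\<dots> = (\<Sum>k<N. if k = i then M $$ (i, j) else 0)"
    using ij by (intro sum.cong) (auto simp: orthonormal)
  finally show "op_mat (mat_op M) $$ (i, j) = M $$ (i, j)"
    using ij by (simp add: op_mat_def)
qed (use assms in \<open>auto simp: op_mat_def\<close>)

lemma op_mat_scaleC_id: "op_mat (c *\<^sub>C id_blinfun) = c \<cdot>\<^sub>m 1\<^sub>m N"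
  by (rule eq_matI) (auto simp: op_mat_def scaleC_blinfun.rep_eq cinner_scaleC_left orthonormal)

text \<open>Both sides have the same matrix by the adjugate identity, and the matrix determines a
  complex-linear operator.\<close>

lemma compose_adjugate:
  assumes "A \<in> bounded_ops"
  shows "A o\<^sub>L mat_op (adj_mat (op_mat A)) = Determinant.det (op_mat A) *\<^sub>C id_blinfun"
    and "mat_op (adj_mat (op_mat A)) o\<^sub>L A = Determinant.det (op_mat A) *\<^sub>C id_blinfun"
  by (rule op_mat_inj; simp add: assms op_mat_compose op_mat_mat_op op_mat_scaleC_id
      adj_mat[OF op_mat_carrier])+

lemma op_inverse_eq_adjugate:
  assumes A: "A \<in> bounded_ops"
  shows "op_inverse A = inverse (Determinant.det (op_mat A)) *\<^sub>C mat_op (adj_mat (op_mat A))"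
proof (cases "Determinant.det (op_mat A) = 0")
  \<comment> \<open>Both sides are 0 here: the right one because \<open>inverse 0 = 0\<close>, the
    left one by the default value of \<open>op_inverse\<close>, once multiplicativity of the
    determinant has excluded an inverse.\<close>
  case True
  have "\<not> op_invertible A"
  proof
    assume inv: "op_invertible A"
    have "(1::complex) \<cdot>\<^sub>m 1\<^sub>m N = 1\<^sub>m N" by (rule eq_matI) auto
    then have "op_mat A * op_mat (op_inverse A) = 1\<^sub>m N"
      using op_mat_scaleC_id[of 1] unfolding op_mat_compose[OF A, symmetric] op_inverse_right[OF inv]
      by simp
    then have "Determinant.det (op_mat A) * Determinant.det (op_mat (op_inverse A)) = 1"
      by (metis det_mult det_one op_mat_carrier)
    with True show False by simp
  qed
  with True show ?thesis by (simp add: op_inverse_def)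
next
  case False
  then show ?thesis
    by (intro op_inverse_eqI(1))
      (simp_all add: blinfun_compose_scaleC_left blinfun_compose_scaleC_right A compose_adjugate scaleC_scaleC)
qed

lemma holomorphic_on_op_mat:
  assumes "vec_holomorphic_on F S" "i < N" "j < N"
  shows "(\<lambda>z. op_mat (F z) $$ (i, j)) holomorphic_on S"
proof -
  have "vec_holomorphic_on (\<lambda>z. cinner (blinfun_apply (F z) (e j)) (e i)) S"
    unfolding vec_holomorphic_on_def
  proof
    fix z assume "z \<in> S"
    with assms obtain D where D: "(F has_derivative (\<lambda>h. h *\<^sub>C D)) (at z within S)"
      unfolding vec_holomorphic_on_def by blast
    have "bounded_linear (\<lambda>A::'k \<Rightarrow>\<^sub>L 'k. cinner (blinfun_apply A (e j)) (e i))"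
      by (rule bounded_linear_compose[OF
            bounded_bilinear.bounded_linear_left[OF bounded_bilinear_cinner]
            blinfun.bounded_linear_left])
    from bounded_linear.has_derivative[OF this D]
    show "\<exists>D. ((\<lambda>z. cinner (blinfun_apply (F z) (e j)) (e i)) has_derivative (\<lambda>h. h *\<^sub>C D)) (at z within S)"
      by (intro exI[of _ "cinner (blinfun_apply D (e j)) (e i)"])
        (simp add: scaleC_blinfun.rep_eq cinner_scaleC_left scaleC_complex_def)
  qed
  then show ?thesis using assms by (simp add: op_mat_def vec_holomorphic_on_complex)
qed

lemma vec_holomorphic_on_mat_op:
  assumes "\<And>i j. i < N \<Longrightarrow> j < N \<Longrightarrow> (\<lambda>z. M z $$ (i, j)) holomorphic_on S"
  shows "vec_holomorphic_on (\<lambda>z. mat_op (M z)) S"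
  unfolding mat_op_def
  by (intro vec_holomorphic_on_sum vec_holomorphic_on_scaleC vec_holomorphic_on_const assms) auto

text \<open>By connectedness the determinant either vanishes identically or has isolated zeros of
  finite order. In the first case the inverse is constantly 0 by its default value; in the second
  the adjugate formula has poles of at most those orders.\<close>

lemma vec_meromorphic_on_op_inverse:
  fixes F :: "complex \<Rightarrow> 'k \<Rightarrow>\<^sub>L 'k"
  assumes hol: "vec_holomorphic_on F S" and F: "\<And>z. z \<in> S \<Longrightarrow> F z \<in> bounded_ops"
    and S: "open S" "connected S"
  shows "vec_meromorphic_on (\<lambda>z. op_inverse (F z)) S"
proof -
  define d where "d z = Determinant.det (op_mat (F z))" for z
  define G where "G z = mat_op (adj_mat (op_mat (F z)))" for z
  have inv: "op_inverse (F z) = inverse (d z) *\<^sub>C G z" if "z \<in> S" for z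
    unfolding d_def G_def by (rule op_inverse_eq_adjugate[OF F[OF that]])
  have d: "d holomorphic_on S"
    unfolding d_def by (rule holomorphic_on_det[where n = N]) (simp_all add: holomorphic_on_op_mat[OF hol])
  have G: "vec_holomorphic_on G S"
    unfolding G_def
    by (rule vec_holomorphic_on_mat_op, rule holomorphic_on_adj_mat[where n = N])
      (simp_all add: holomorphic_on_op_mat[OF hol])
  show ?thesis
  proof (cases "\<forall>z\<in>S. d z = 0")
    case True
    then have "vec_holomorphic_on (\<lambda>z. op_inverse (F z)) S"
      using inv by (intro vec_holomorphic_on_transform[OF vec_holomorphic_on_const[of 0]]) simp
    then show ?thesis using S(1) by (rule vec_holomorphic_on_imp_meromorphic_on)
  next
    case False
    then obtain z0 where z0: "z0 \<in> S" "d z0 \<noteq> 0" by blast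
    show ?thesis
      unfolding vec_meromorphic_on_def
    proof
      fix z assume z: "z \<in> S"
      \<comment> \<open>Local factorisation of the determinant into a power of \<open>w - z\<close>
        and a zero-free holomorphic factor, with \<open>m = 0\<close> where the determinant does not
        vanish.\<close>
      obtain g r m where g: "0 < r" "ball z r \<subseteq> S" "g holomorphic_on ball z r"
        "\<And>w. w \<in> ball z r \<Longrightarrow> d w = (w - z) ^ m * g w" "\<And>w. w \<in> ball z r \<Longrightarrow> g w \<noteq> 0"
      proof (cases "d z = 0")
        case True
        then have "\<not> d constant_on S" using z z0 unfolding constant_on_def by metis
        from holomorphic_factor_zero_nonconstant[OF d S z True this] show thesis using that by metis
      next
        case False
        have "open {w \<in> S. d w \<noteq> 0}"
          using continuous_open_preimage[OF holomorphic_on_imp_continuous_on[OF d] S(1), of "- {0}"]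
          by (simp add: vimage_def Int_def open_Compl)
        then obtain r where r: "0 < r" "ball z r \<subseteq> {w \<in> S. d w \<noteq> 0}" using z False openE by blast
        then have "ball z r \<subseteq> S" by blast
        with r show thesis using that[of r d 0] holomorphic_on_subset[OF d, of "ball z r"] by fastforce
      qed
      have "vec_holomorphic_on (\<lambda>w. inverse (g w) *\<^sub>C G w) (ball z r)"
        using g G by (intro vec_holomorphic_on_scaleC holomorphic_intros) (auto intro: vec_holomorphic_on_subset)
      moreover have "(w - z) ^ m *\<^sub>C op_inverse (F w) = inverse (g w) *\<^sub>C G w" if "w \<in> ball z r - {z}" for w
        using that g(2) g(4)[of w] g(5)[of w] by (subst inv) (auto simp: scaleC_scaleC)
      ultimately show "\<exists>m g r. 0 < r \<and> vec_holomorphic_on g (ball z r) \<and>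
          (\<forall>w\<in>ball z r - {z}. (w - z) ^ m *\<^sub>C op_inverse (F w) = g w)"
        using g(1) by blast
    qed
  qed
qed

end

section \<open>Finite orthonormal bases from the Hilbert dimension\<close>

lemma orthogonal_dense_span_zero:
  assumes "closure (cspan B) = UNIV" "\<And>b. b \<in> B \<Longrightarrow> cinner b y = 0"
  shows "y = 0"
proof -
  have "csubspace {x. cinner x y = 0}"
    by (simp add: complex_vector.subspace_def cinner_add_left cinner_scaleC_left)
  then have "cspan B \<subseteq> {x. cinner x y = 0}"
    using assms(2) by (intro complex_vector.span_minimal) auto
  moreover have "closed {x. cinner x y = 0}"
    by (intro closed_Collect_eq continuous_intros
        bounded_bilinear.continuous_on[OF bounded_bilinear_cinner])
  ultimately have "closure (cspan B) \<subseteq> {x. cinner x y = 0}" by (rule closure_minimal)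
  then have "cinner y y = 0" using assms(1) by blast
  then show ?thesis by simp
qed

text \<open>Density of the span suffices: the remainder of the expansion is orthogonal to
  \<open>B\<close>, hence to the closure of its span, and so to itself.\<close>

lemma has_hilbert_dim_finite_onb:
  assumes "has_hilbert_dim (UNIV :: 'k::complex_hilbert set) (enat N)"
  obtains e :: "nat \<Rightarrow> 'k::complex_hilbert" where "finite_onb e N"
proof -
  obtain B :: "'k set" where B: "corthonormal B" "closure (cspan B) = UNIV" "finite B" "card B = N"
    using assms unfolding has_hilbert_dim_def by (metis enat.distinct(2) enat.inject)
  obtain e where e: "bij_betw e {0..<N} B"
    using ex_bij_betw_nat_finite[OF B(3)] B(4) by blast
  have orth: "cinner (e i) (e j) = (if i = j then 1 else 0)" if "i < N" "j < N" for i j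
    using B(1) e that unfolding corthonormal_def bij_betw_def inj_on_def
    by (metis atLeastLessThan_iff imageI le0)
  have "x = (\<Sum>i<N. cinner x (e i) *\<^sub>C e i)" for x
  proof -
    define y where "y = x - (\<Sum>i<N. cinner x (e i) *\<^sub>C e i)"
    have "y = 0"
    proof (rule orthogonal_dense_span_zero[OF B(2)])
      fix b assume "b \<in> B"
      then obtain k where k: "k < N" "b = e k" using e by (auto simp: bij_betw_def)
      have "cinner y b = cinner x b - (\<Sum>i<N. cinner x (e i) * cinner (e i) b)"
        by (simp add: y_def cinner_diff_left cinner_sum_left cinner_scaleC_left)
      also have "(\<Sum>i<N. cinner x (e i) * cinner (e i) b) = (\<Sum>i<N. if i = k then cinner x b else 0)"
        using k by (intro sum.cong) (auto simp: orth)
      finally have "cinner y b = 0" using k by simp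
      then show "cinner b y = 0" by (simp add: cinner_commute[of b])
    qed
    then show ?thesis by (simp add: y_def)
  qed
  with orth show thesis using that unfolding finite_onb_def by blast
qed

section \<open>The kernel identity\<close>

text \<open>Isometry of the Cayley transform, polarised and written without inverses; the mixed
  terms cancel on each side by symmetry.\<close>

lemma symmetric_shift_cinner:
  assumes "cinner (T x) y = cinner x (T y)"
  shows "cinner (T x - \<i> *\<^sub>C x) (T y - \<i> *\<^sub>C y) = cinner (T x + \<i> *\<^sub>C x) (T y + \<i> *\<^sub>C y)"
  using assms by (simp add: cinner_simps algebra_simps)

text \<open>The cross terms cancel by symmetry. The resulting bound of \<open>norm x\<close> by
  \<open>norm (T x - s *\<^sub>C x)\<close> is what makes the ranges of T - \<i> and T + \<i>
  closed.\<close>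

lemma symmetric_shift_norm:
  assumes "cinner (T x) x = cinner x (T x)" "s = \<i> \<or> s = - \<i>"
  shows "(norm (T x - s *\<^sub>C x))\<^sup>2 = (norm (T x))\<^sup>2 + (norm x)\<^sup>2"
proof -
  have "cinner (T x - s *\<^sub>C x) (T x - s *\<^sub>C x) = cinner (T x) (T x) + cinner x x"
    using assms by (auto simp: cinner_simps algebra_simps)
  then have "complex_of_real ((norm (T x - s *\<^sub>C x))\<^sup>2) = of_real ((norm (T x))\<^sup>2 + (norm x)\<^sup>2)"
    by (simp only: cinner_self of_real_add)
  then show ?thesis by (simp only: of_real_eq_iff)
qed

lemma csubspace_imp_subspace: "csubspace M \<Longrightarrow> subspace M"
  by (simp add: subspace_def complex_vector.subspace_def scaleR_scaleC)

lemma csubspace_rng_shift: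
  assumes "closed_densely_defined D T"
  shows "csubspace (rng_shift D T l)"
proof -
  have D: "csubspace D" and add: "\<And>x y. x \<in> D \<Longrightarrow> y \<in> D \<Longrightarrow> T (x + y) = T x + T y"
    and scale: "\<And>c x. x \<in> D \<Longrightarrow> T (c *\<^sub>C x) = c *\<^sub>C T x"
    using assms by (auto simp: closed_densely_defined_def)
  show ?thesis
    unfolding complex_vector.subspace_def
  proof (intro conjI ballI allI)
    have "0 \<in> D" using D by (rule complex_vector.subspace_0)
    then show "0 \<in> rng_shift D T l"
      unfolding rng_shift_def using scale[of 0 0] by (intro image_eqI[of _ _ 0]) auto
    fix u v c assume "u \<in> rng_shift D T l" "v \<in> rng_shift D T l"
    then obtain x y where xy: "x \<in> D" "u = T x - l *\<^sub>C x" "y \<in> D" "v = T y - l *\<^sub>C y"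
      by (auto simp: rng_shift_def)
    then have "x + y \<in> D" using D by (simp add: complex_vector.subspace_add)
    moreover have "u + v = T (x + y) - l *\<^sub>C (x + y)"
      using xy by (simp add: add scaleC_add_right)
    ultimately show "u + v \<in> rng_shift D T l" unfolding rng_shift_def by blast
    have "c *\<^sub>C x \<in> D" using D xy by (simp add: complex_vector.subspace_scale)
    moreover have "c *\<^sub>C u = T (c *\<^sub>C x) - l *\<^sub>C (c *\<^sub>C x)"
      using xy by (simp add: scale complex_vector.scale_right_diff_distrib scaleC_scaleC mult.commute)
    ultimately show "c *\<^sub>C u \<in> rng_shift D T l" unfolding rng_shift_def by blast
  qed
qed

text \<open>By the norm identity, convergence of the images forces the preimages to be Cauchy; the
  closed graph of \<open>T\<close> then places the limit in the range.\<close>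

lemma closed_rng_shift:
  fixes T :: "'a::complex_hilbert \<Rightarrow> 'a"
  assumes cdd: "closed_densely_defined D T"
    and sym: "\<And>x y. x \<in> D \<Longrightarrow> y \<in> D \<Longrightarrow> cinner (T x) y = cinner x (T y)"
    and s: "s = \<i> \<or> s = - \<i>"
  shows "closed (rng_shift D T s)"
  unfolding closed_sequential_limits
proof (intro allI impI)
  fix u v assume "(\<forall>n. u n \<in> rng_shift D T s) \<and> u \<longlonglongrightarrow> v"
  then obtain x where x: "\<And>n. x n \<in> D" and u: "\<And>n. u n = T (x n) - s *\<^sub>C x n" and lim: "u \<longlonglongrightarrow> v"
    unfolding rng_shift_def image_iff by metis
  have D: "csubspace D" and add: "\<And>x y. x \<in> D \<Longrightarrow> y \<in> D \<Longrightarrow> T (x + y) = T x + T y"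
    and scale: "\<And>c x. x \<in> D \<Longrightarrow> T (c *\<^sub>C x) = c *\<^sub>C T x"
    and graph: "closed ((\<lambda>x. (x, T x)) ` D)"
    using cdd by (auto simp: closed_densely_defined_def)
  have "Cauchy x"
  proof (rule metric_CauchyI)
    fix \<epsilon> :: real assume "0 < \<epsilon>"
    then obtain N where N: "\<And>m n. m \<ge> N \<Longrightarrow> n \<ge> N \<Longrightarrow> dist (u m) (u n) < \<epsilon>"
      using LIMSEQ_imp_Cauchy[OF lim] metric_CauchyD by metis
    have "dist (x m) (x n) \<le> dist (u m) (u n)" for m n
    proof -
      have d: "x m - x n \<in> D" using D x by (simp add: complex_vector.subspace_diff)
      have "T (x m - x n) = T (x m) - T (x n)"
        using add[OF d x[of n]] by (simp add: algebra_simps)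
      then have "u m - u n = T (x m - x n) - s *\<^sub>C (x m - x n)"
        by (simp add: u complex_vector.scale_right_diff_distrib)
      then have "(norm (x m - x n))\<^sup>2 \<le> (norm (u m - u n))\<^sup>2"
        using symmetric_shift_norm[of T, OF sym[OF d d] s] by simp
      then show ?thesis unfolding dist_norm by (rule power2_le_imp_le) simp
    qed
    with N show "\<exists>N. \<forall>m\<ge>N. \<forall>n\<ge>N. dist (x m) (x n) < \<epsilon>" by (meson order_le_less_trans)
  qed
  then obtain y where y: "x \<longlonglongrightarrow> y" using Cauchy_convergent convergent_def by blast
  have "(\<lambda>n. u n + s *\<^sub>C x n) \<longlonglongrightarrow> v + s *\<^sub>C y"
    by (intro tendsto_add lim bounded_bilinear.tendsto[OF bounded_bilinear_scaleC] tendsto_const y)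
  then have "(\<lambda>n. T (x n)) \<longlonglongrightarrow> v + s *\<^sub>C y" by (simp add: u)
  then have "(\<lambda>n. (x n, T (x n))) \<longlonglongrightarrow> (y, v + s *\<^sub>C y)" by (intro tendsto_Pair y)
  from closed_sequentially[OF graph _ this] have "(y, v + s *\<^sub>C y) \<in> (\<lambda>x. (x, T x)) ` D"
    using x by blast
  then have "y \<in> D" "T y = v + s *\<^sub>C y" by auto
  then show "v \<in> rng_shift D T s" unfolding rng_shift_def by (intro image_eqI[of _ _ y]) auto
qed

lemma double_corthogonal_comp:
  fixes M :: "'a::complex_hilbert set"
  assumes "closed M" and M: "csubspace M" and w: "\<And>v. v \<in> corthogonal_comp M \<Longrightarrow> cinner w v = 0"
  shows "w \<in> M"
proof -
  obtain m where m: "m \<in> M" and orth: "\<And>v. v \<in> M \<Longrightarrow> inner (w - m) v = 0"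
    using orthogonal_decomposition[OF assms(1) csubspace_imp_subspace[OF M]] by metis
  \<comment> \<open>The decomposition is orthogonal for the real inner product. Since
    \<open>M\<close> is stable under multiplication by \<open>\<i>\<close>, it is orthogonal for the
    complex one too.\<close>
  have c: "cinner v (w - m) = 0" if v: "v \<in> M" for v
  proof (rule complex_eqI)
    show "Re (cinner v (w - m)) = Re 0"
      using orth[OF v] by (simp add: Re_cinner inner_commute)
    have "Re (cinner (\<i> *\<^sub>C v) (w - m)) = 0"
      using orth[of "\<i> *\<^sub>C v"] v M by (simp add: Re_cinner inner_commute complex_vector.subspace_scale)
    then show "Im (cinner v (w - m)) = Im 0" by (simp add: cinner_scaleC_left)
  qed
  then have "w - m \<in> corthogonal_comp M" by (simp add: corthogonal_comp_def)
  then have "cinner w (w - m) = 0" by (rule w)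
  with c[OF m] have "cinner (w - m) (w - m) = 0" by (simp add: cinner_diff_left)
  then show ?thesis using m by simp
qed

text \<open>The isometric Cayley transform of T sends the component of u in the range of \<open>T + \<i>\<close>, up to the
  factor \<open>cnj (blaschke l)\<close>, to its component in the range of \<open>T - \<i>\<close>.\<close>

lemma deficiency_kernel_identity:
  assumes cdd: "closed_densely_defined D T"
    and sym: "\<And>x y. x \<in> D \<Longrightarrow> y \<in> D \<Longrightarrow> cinner (T x) y = cinner x (T y)"
    and l: "l \<noteq> - \<i>" and z: "z \<noteq> - \<i>"
    and u: "u \<in> corthogonal_comp (rng_shift D T l)" and v: "v \<in> corthogonal_comp (rng_shift D T z)"
    and u1: "u - p \<in> rng_shift D T \<i>" "p \<in> corthogonal_comp (rng_shift D T \<i>)"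
    and u2: "u - p' \<in> rng_shift D T (- \<i>)" "p' \<in> corthogonal_comp (rng_shift D T (- \<i>))"
    and v1: "v - q \<in> rng_shift D T \<i>" "q \<in> corthogonal_comp (rng_shift D T \<i>)"
    and v2: "v - q' \<in> rng_shift D T (- \<i>)" "q' \<in> corthogonal_comp (rng_shift D T (- \<i>))"
  shows "(1 - cnj (blaschke l) * blaschke z) * cinner u v
    = cinner p v - cnj (blaschke l) * blaschke z * cinner p' v"
proof -
  have D: "csubspace D" and add: "\<And>x y. x \<in> D \<Longrightarrow> y \<in> D \<Longrightarrow> T (x + y) = T x + T y"
    and scale: "\<And>c x. x \<in> D \<Longrightarrow> T (c *\<^sub>C x) = c *\<^sub>C T x"
    using cdd by (auto simp: closed_densely_defined_def)
  \<comment> \<open>Stated for arbitrary \<open>k\<close> and \<open>w\<close>, because it is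
    applied to \<open>u\<close> with \<open>l\<close> and to \<open>v\<close> with
    \<open>z\<close>.\<close>
  have cayley: "T x + \<i> *\<^sub>C x = cnj (blaschke k) *\<^sub>C (T x' + \<i> *\<^sub>C x')"
    if k: "k \<noteq> - \<i>" and w: "w \<in> corthogonal_comp (rng_shift D T k)"
      and x: "x \<in> D" "w - r = T x - \<i> *\<^sub>C x" "r \<in> corthogonal_comp (rng_shift D T \<i>)"
      and x': "x' \<in> D" "w - r' = T x' - (- \<i>) *\<^sub>C x'" "r' \<in> corthogonal_comp (rng_shift D T (- \<i>))"
    for k w r r' x x'
  proof -
    \<comment> \<open>\<open>w\<close> is an eigenvector of the adjoint of \<open>T\<close> for the
      eigenvalue \<open>cnj k\<close>, expressed by pairing with vectors of the domain.\<close>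
    have w_eq: "cinner (T y) w = k * cinner y w" if "y \<in> D" for y
      using w that by (auto simp: corthogonal_comp_def rng_shift_def cinner_simps)
    have r: "cinner (T y - \<i> *\<^sub>C y) r = 0" if "y \<in> D" for y
      using x(3) that by (auto simp: corthogonal_comp_def rng_shift_def)
    have r': "cinner (T y + \<i> *\<^sub>C y) r' = 0" if "y \<in> D" for y
      using x'(3) that by (auto simp: corthogonal_comp_def rng_shift_def)
    \<comment> \<open>The defect of the claim. It is orthogonal to the range of T + \<i> and also
      belongs to it, hence vanishes.\<close>
    define h where "h = (T x + \<i> *\<^sub>C x) - cnj (blaschke k) *\<^sub>C (T x' + \<i> *\<^sub>C x')"
    have 1: "cinner (T y + \<i> *\<^sub>C y) h = 0" if y: "y \<in> D" for y
    proof -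
      have "cinner (T y + \<i> *\<^sub>C y) (T x + \<i> *\<^sub>C x) = cinner (T y - \<i> *\<^sub>C y) (w - r)"
        using symmetric_shift_cinner[of T y x] sym[OF y x(1)] by (simp add: x(2))
      also have "\<dots> = (k - \<i>) * cinner y w"
        using r[OF y] by (simp add: cinner_diff_right cinner_diff_left[of _ _ w] cinner_scaleC_left w_eq[OF y] algebra_simps)
      finally have a: "cinner (T y + \<i> *\<^sub>C y) (T x + \<i> *\<^sub>C x) = (k - \<i>) * cinner y w" .
      have "cinner (T y + \<i> *\<^sub>C y) (T x' + \<i> *\<^sub>C x') = cinner (T y + \<i> *\<^sub>C y) (w - r')"
        using x'(2) by simp
      also have "\<dots> = (k + \<i>) * cinner y w"
        using r'[OF y] by (simp add: cinner_diff_right cinner_add_left[of _ _ w] cinner_scaleC_left w_eq[OF y] algebra_simps)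
      finally have b: "cinner (T y + \<i> *\<^sub>C y) (T x' + \<i> *\<^sub>C x') = (k + \<i>) * cinner y w" .
      have "k + \<i> \<noteq> 0" using k by (simp add: add_eq_0_iff2)
      then show ?thesis
        unfolding h_def cinner_diff_right cinner_scaleC_right a b by (simp add: blaschke_def)
    qed
    define y where "y = x - cnj (blaschke k) *\<^sub>C x'"
    have cx': "- cnj (blaschke k) *\<^sub>C x' \<in> D" using D x' by (simp only: complex_vector.subspace_scale)
    then have "x + - cnj (blaschke k) *\<^sub>C x' \<in> D" using D x(1) complex_vector.subspace_add by blast
    moreover have "T (x + - cnj (blaschke k) *\<^sub>C x') = T x + - cnj (blaschke k) *\<^sub>C T x'"
      by (simp only: add[OF x(1) cx'] scale[OF x'(1)])
    ultimately have y: "y \<in> D" "T y = T x - cnj (blaschke k) *\<^sub>C T x'"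
      by (simp_all add: y_def)
    have "h = T y + \<i> *\<^sub>C y"
      by (simp add: h_def y(2)) (simp add: y_def complex_vector.scale_right_diff_distrib scaleC_add_right scaleC_scaleC algebra_simps)
    with 1[OF y(1)] have "cinner h h = 0" by simp
    then have "h = 0" by simp
    then show ?thesis by (simp add: h_def)
  qed
  obtain x where x: "x \<in> D" "u - p = T x - \<i> *\<^sub>C x" using u1 by (auto simp: rng_shift_def)
  obtain x' where x': "x' \<in> D" "u - p' = T x' - (- \<i>) *\<^sub>C x'" using u2 unfolding rng_shift_def by blast
  obtain y where y: "y \<in> D" "v - q = T y - \<i> *\<^sub>C y" using v1 by (auto simp: rng_shift_def)
  obtain y' where y': "y' \<in> D" "v - q' = T y' - (- \<i>) *\<^sub>C y'" using v2 unfolding rng_shift_def by blast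
  \<comment> \<open>\<open>q\<close> is orthogonal to the range that contains \<open>u - p\<close>,
    so \<open>v\<close> may be replaced by its component \<open>v - q\<close>; likewise for the
    primed decomposition.\<close>
  have "cinner (u - p) q = 0" "cinner (u - p') q' = 0"
    using u1(1) u2(1) v1(2) v2(2) by (auto simp: corthogonal_comp_def)
  then have "cinner (u - p) v = cinner (u - p) (v - q)" "cinner (u - p') v = cinner (u - p') (v - q')"
    by (simp_all add: cinner_diff_right)
  moreover have "cinner (u - p) (v - q) = cinner (T x + \<i> *\<^sub>C x) (T y + \<i> *\<^sub>C y)"
    unfolding x(2) y(2) by (rule symmetric_shift_cinner[of T, OF sym[OF x(1) y(1)]])
  \<comment> \<open>The Cayley factor of the left argument comes out unchanged and that of the right
    one conjugated, whence \<open>cnj (blaschke l)\<close> beside \<open>blaschke z\<close>.\<close>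
  moreover have "\<dots> = cnj (blaschke l) * blaschke z * cinner (u - p') (v - q')"
    unfolding cayley[OF l u x u1(2) x' u2(2)] cayley[OF z v y v1(2) y' v2(2)]
    by (simp add: x'(2) y'(2) cinner_scaleC_left cinner_scaleC_right)
  ultimately have "cinner (u - p) v = cnj (blaschke l) * blaschke z * cinner (u - p') v" by simp
  then show ?thesis by (simp add: cinner_diff_left algebra_simps)
qed

text \<open>\<open>P\<close> is the orthogonal projection onto the range of \<open>G\<close>:
  \<open>op_adj G\<close> annihilates the remainder, which is thus orthogonal to the complement of
  \<open>M\<close> and lies in \<open>M\<close> because \<open>M\<close> is closed.\<close>

lemma gram_projection:
  fixes G :: "'k::complex_hilbert \<Rightarrow>\<^sub>L 'h::complex_hilbert"
  assumes G: "G \<in> bounded_ops" and inv: "op_invertible (op_adj G o\<^sub>L G)"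
    and range: "range (blinfun_apply G) = corthogonal_comp M" and M: "closed M" "csubspace M"
  defines "P \<equiv> G o\<^sub>L (op_inverse (op_adj G o\<^sub>L G) o\<^sub>L op_adj G)"
  shows "u - blinfun_apply P u \<in> M" "blinfun_apply P u \<in> corthogonal_comp M"
proof -
  show "blinfun_apply P u \<in> corthogonal_comp M"
    unfolding range[symmetric] by (simp add: P_def)
  show "u - blinfun_apply P u \<in> M"
  proof (rule double_corthogonal_comp[OF M])
    fix v assume "v \<in> corthogonal_comp M"
    then obtain k where k: "v = blinfun_apply G k" unfolding range[symmetric] by blast
    have "blinfun_apply (op_adj G) (blinfun_apply P u) = blinfun_apply (op_adj G) u"
      using op_inverse_apply_right[OF inv, of "blinfun_apply (op_adj G) u"] by (simp add: P_def)
    then have "blinfun_apply (op_adj G) (u - blinfun_apply P u) = 0"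
      by (simp add: blinfun.diff_right)
    then show "cinner (u - blinfun_apply P u) v = 0"
      unfolding k cinner_op_adj_left[OF G, symmetric] by simp
  qed
qed

section \<open>The characteristic function of a model\<close>

text \<open>The difference of the squared distances of \<open>z\<close> from -\<i> and from \<i> is
  \<open>4 * Im z\<close>.\<close>

lemma norm_blaschke_less_1:
  assumes "Im z > 0"
  shows "cmod (blaschke z) < 1"
proof -
  have "(cmod (z - \<i>))\<^sup>2 < (cmod (z + \<i>))\<^sup>2"
    unfolding cmod_power2 using assms by (simp add: power2_eq_square algebra_simps)
  then have "cmod (z - \<i>) < cmod (z + \<i>)" by (rule power2_less_imp_less) simp
  then show ?thesis by (simp add: blaschke_def norm_divide divide_less_eq)
qed

lemma holomorphic_on_blaschke: "- \<i> \<notin> S \<Longrightarrow> blaschke holomorphic_on S"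
  unfolding blaschke_def[abs_def] by (intro holomorphic_intros) (auto simp: add_eq_0_iff2)

text \<open>The only singularity is the simple pole at -\<i>, removed by the factor
  \<open>w + \<i>\<close>.\<close>

lemma vec_meromorphic_on_blaschke: "vec_meromorphic_on blaschke S"
proof -
  have 1: "vec_meromorphic_on blaschke (- {- \<i>})"
    by (intro vec_holomorphic_on_imp_meromorphic_on)
      (auto simp: vec_holomorphic_on_complex holomorphic_on_blaschke open_Compl)
  have "(\<lambda>w. w - \<i>) holomorphic_on ball (- \<i>) 1" by (intro holomorphic_intros)
  moreover have "(w - - \<i>) ^ 1 *\<^sub>C blaschke w = w - \<i>" if "w \<in> ball (- \<i>) 1 - {- \<i>}" for w
    using that by (simp add: scaleC_complex_def blaschke_def add_eq_0_iff2)
  ultimately have "vec_meromorphic_on blaschke {- \<i>}"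
    unfolding vec_meromorphic_on_def
    by (simp add: vec_holomorphic_on_complex)
      (intro exI[of _ 1] exI[of _ "\<lambda>w. w - \<i>"] exI[of _ "1::real"], simp)
  with 1 have "vec_meromorphic_on blaschke (- {- \<i>} \<union> {- \<i>})"
    by (simp only: vec_meromorphic_on_Un)
  then show ?thesis by (rule vec_meromorphic_on_subset) auto
qed

locale symmetric_model =
  fixes D :: "'h::complex_hilbert set" and T :: "'h \<Rightarrow> 'h"
    and \<Gamma> :: "complex \<Rightarrow> 'k::complex_hilbert \<Rightarrow>\<^sub>L 'h"
  assumes cdd: "closed_densely_defined D T"
    and sym: "x \<in> D \<Longrightarrow> y \<in> D \<Longrightarrow> cinner (T x) y = cinner x (T y)"
    and model: "is_model D T \<Gamma>"
begin

abbreviation "\<Phi> \<equiv> model_Phi \<Gamma>"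
abbreviation "\<Psi> \<equiv> model_Psi \<Gamma>"
abbreviation "V \<equiv> model_V \<Gamma>"
abbreviation "K \<equiv> model_kernel \<Gamma>"

lemma Gamma_ops [simp]: "Im l \<noteq> 0 \<Longrightarrow> \<Gamma> l \<in> bounded_ops"
  using model by (simp add: is_model_def)

lemma Gamma_coholomorphic: "vec_coholomorphic_on \<Gamma> nonreal"
  using model by (simp add: is_model_def)

lemma Gamma_range: "Im l \<noteq> 0 \<Longrightarrow> range (blinfun_apply (\<Gamma> l)) = corthogonal_comp (rng_shift D T l)"
  using model by (simp add: is_model_def bij_betw_def)

lemma K_invertible:
  "Im l > 0 \<and> Im z > 0 \<or> Im l < 0 \<and> Im z < 0 \<Longrightarrow> op_invertible (op_adj (\<Gamma> z) o\<^sub>L \<Gamma> l)"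
  using model unfolding is_model_def by blast

lemma open_nonreal: "open nonreal"
  by (intro open_Collect_neq continuous_intros)

lemma K_ops [simp]: "Im l \<noteq> 0 \<Longrightarrow> Im z \<noteq> 0 \<Longrightarrow> K l z \<in> bounded_ops"
  by (simp add: model_kernel_def)

lemma K_holomorphic: "vec_holomorphic_on (\<lambda>z. K l z) nonreal"
  unfolding model_kernel_def
  by (intro vec_holomorphic_on_compose vec_holomorphic_on_op_adj vec_holomorphic_on_const
      Gamma_coholomorphic open_nonreal) simp_all

text \<open>Joint continuity in both variables carries the kernel formula to the pairs where one of
  its factors is singular.\<close>

lemma K_continuous: "continuous_on (nonreal \<times> nonreal) (\<lambda>(l, z). K l z)"
proof -
  have "continuous_on nonreal (\<lambda>z. op_adj (\<Gamma> z))"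
    by (intro vec_holomorphic_on_continuous_on vec_holomorphic_on_op_adj Gamma_coholomorphic
        open_nonreal) simp
  then have "continuous_on (nonreal \<times> nonreal) (\<lambda>p. op_adj (\<Gamma> (snd p)))"
    by (rule continuous_on_compose2) (auto intro: continuous_intros)
  moreover have "continuous_on (nonreal \<times> nonreal) (\<lambda>p. \<Gamma> (fst p))"
    by (rule continuous_on_compose2[OF vec_coholomorphic_on_continuous_on[OF Gamma_coholomorphic]])
      (auto intro: continuous_intros)
  ultimately show ?thesis
    unfolding model_kernel_def case_prod_beta by (intro blinfun_comp.continuous_on)
qed

lemma gram_at_plus_minus_i:
  "\<Gamma> \<i> \<in> bounded_ops" "op_invertible (op_adj (\<Gamma> \<i>) o\<^sub>L \<Gamma> \<i>)"
  "\<Gamma> (- \<i>) \<in> bounded_ops" "op_invertible (op_adj (\<Gamma> (- \<i>)) o\<^sub>L \<Gamma> (- \<i>))"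
  by (auto intro: K_invertible)

lemmas sqrt_plus = op_sqrt_gram[OF gram_at_plus_minus_i(1,2)]
lemmas sqrt_minus = op_sqrt_gram[OF gram_at_plus_minus_i(3,4)]

lemma Phi_ops [simp]: "Im z \<noteq> 0 \<Longrightarrow> \<Phi> z \<in> bounded_ops"
  unfolding model_Phi_def using sqrt_plus(1) by (simp add: model_kernel_def)

lemma Psi_ops [simp]: "Im z \<noteq> 0 \<Longrightarrow> \<Psi> z \<in> bounded_ops"
  unfolding model_Psi_def using sqrt_minus(1) by (simp add: model_kernel_def)

lemma V_ops [simp]: "Im z \<noteq> 0 \<Longrightarrow> V z \<in> bounded_ops"
  unfolding model_V_def by simp

lemma Phi_holomorphic: "vec_holomorphic_on \<Phi> nonreal"
  unfolding model_Phi_def[abs_def]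
  by (intro vec_holomorphic_on_compose vec_holomorphic_on_const K_holomorphic) simp

lemma Psi_holomorphic: "vec_holomorphic_on \<Psi> nonreal"
  unfolding model_Psi_def[abs_def]
  by (intro vec_holomorphic_on_compose vec_holomorphic_on_const K_holomorphic) simp

section \<open>Factorisation of the kernel\<close>

lemma Phi_Phi_adj:
  assumes "Im l \<noteq> 0" "Im z \<noteq> 0"
  shows "\<Phi> z o\<^sub>L op_adj (\<Phi> l) = op_adj (\<Gamma> z) o\<^sub>L
    ((\<Gamma> \<i> o\<^sub>L (op_inverse (op_adj (\<Gamma> \<i>) o\<^sub>L \<Gamma> \<i>) o\<^sub>L op_adj (\<Gamma> \<i>))) o\<^sub>L \<Gamma> l)"
proof -
  let ?S = "op_sqrt (op_adj (\<Gamma> \<i>) o\<^sub>L \<Gamma> \<i>)"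
  have "op_adj (op_inverse ?S) = op_inverse ?S"
    using op_inverse_adj(1)[of ?S] sqrt_plus by simp
  then have "op_adj (\<Phi> l) = op_inverse ?S o\<^sub>L (op_adj (\<Gamma> \<i>) o\<^sub>L \<Gamma> l)"
    using assms sqrt_plus(1) by (simp add: model_Phi_def model_kernel_def op_adj_compose)
  then show ?thesis
    by (simp add: model_Phi_def model_kernel_def sqrt_plus(4)[symmetric] blinfun_compose_assoc)
qed

lemma Psi_Psi_adj:
  assumes "Im l \<noteq> 0" "Im z \<noteq> 0"
  shows "\<Psi> z o\<^sub>L op_adj (\<Psi> l) = op_adj (\<Gamma> z) o\<^sub>L
    ((\<Gamma> (- \<i>) o\<^sub>L (op_inverse (op_adj (\<Gamma> (- \<i>)) o\<^sub>L \<Gamma> (- \<i>)) o\<^sub>L op_adj (\<Gamma> (- \<i>)))) o\<^sub>L \<Gamma> l)"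
proof -
  let ?S = "op_sqrt (op_adj (\<Gamma> (- \<i>)) o\<^sub>L \<Gamma> (- \<i>))"
  have "op_adj (op_inverse ?S) = op_inverse ?S"
    using op_inverse_adj(1)[of ?S] sqrt_minus by simp
  then have "op_adj (\<Psi> l) = op_inverse ?S o\<^sub>L (op_adj (\<Gamma> (- \<i>)) o\<^sub>L \<Gamma> l)"
    using assms sqrt_minus(1) by (simp add: model_Psi_def model_kernel_def op_adj_compose)
  then show ?thesis
    by (simp add: model_Psi_def model_kernel_def sqrt_minus(4)[symmetric] blinfun_compose_assoc)
qed

lemma kernel_identity:
  assumes "Im l \<noteq> 0" "l \<noteq> - \<i>" "Im z \<noteq> 0" "z \<noteq> - \<i>"
  shows "(1 - cnj (blaschke l) * blaschke z) *\<^sub>C K l z =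
    (\<Phi> z o\<^sub>L op_adj (\<Phi> l)) - (cnj (blaschke l) * blaschke z) *\<^sub>C (\<Psi> z o\<^sub>L op_adj (\<Psi> l))"
proof -
  define P where "P = \<Gamma> \<i> o\<^sub>L (op_inverse (op_adj (\<Gamma> \<i>) o\<^sub>L \<Gamma> \<i>) o\<^sub>L op_adj (\<Gamma> \<i>))"
  define Q where "Q = \<Gamma> (- \<i>) o\<^sub>L (op_inverse (op_adj (\<Gamma> (- \<i>)) o\<^sub>L \<Gamma> (- \<i>)) o\<^sub>L op_adj (\<Gamma> (- \<i>)))"
  have P: "w - blinfun_apply P w \<in> rng_shift D T \<i>"
    "blinfun_apply P w \<in> corthogonal_comp (rng_shift D T \<i>)" for w
    unfolding P_def
    by (intro gram_projection Gamma_ops K_invertible Gamma_range closed_rng_shift[OF cdd sym]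
        csubspace_rng_shift[OF cdd]; simp)+
  have Q: "w - blinfun_apply Q w \<in> rng_shift D T (- \<i>)"
    "blinfun_apply Q w \<in> corthogonal_comp (rng_shift D T (- \<i>))" for w
    unfolding Q_def
    by (intro gram_projection Gamma_ops K_invertible Gamma_range closed_rng_shift[OF cdd sym]
        csubspace_rng_shift[OF cdd]; simp)+
  show ?thesis
  proof (rule blinfun_eqI, rule cinner_ext_left)
    fix k k'
    define u where "u = blinfun_apply (\<Gamma> l) k"
    define v where "v = blinfun_apply (\<Gamma> z) k'"
    have u: "u \<in> corthogonal_comp (rng_shift D T l)"
      using Gamma_range[OF assms(1)] by (auto simp: u_def)
    have v: "v \<in> corthogonal_comp (rng_shift D T z)"
      using Gamma_range[OF assms(3)] by (auto simp: v_def)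
    \<comment> \<open>\<open>P\<close> and \<open>Q\<close> provide the components of both
      \<open>u\<close> and \<open>v\<close> with respect to both ranges.\<close>
    have "(1 - cnj (blaschke l) * blaschke z) * cinner u v =
        cinner (blinfun_apply P u) v - cnj (blaschke l) * blaschke z * cinner (blinfun_apply Q u) v"
      by (rule deficiency_kernel_identity[OF cdd sym assms(2) assms(4) u v P Q P Q])
    then show "cinner (blinfun_apply ((1 - cnj (blaschke l) * blaschke z) *\<^sub>C K l z) k) k' =
        cinner (blinfun_apply ((\<Phi> z o\<^sub>L op_adj (\<Phi> l)) -
          (cnj (blaschke l) * blaschke z) *\<^sub>C (\<Psi> z o\<^sub>L op_adj (\<Psi> l))) k) k'"
      unfolding Phi_Phi_adj[OF assms(1,3)] Psi_Psi_adj[OF assms(1,3)] P_def[symmetric] Q_def[symmetric]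
      by (simp add: scaleC_blinfun.rep_eq blinfun.diff_left cinner_diff_left cinner_scaleC_left
          model_kernel_def cinner_op_adj_left assms u_def v_def)
  qed
qed

lemma Phi_V:
  assumes "Im z \<noteq> 0" "op_invertible (\<Phi> z)"
  shows "\<Phi> z o\<^sub>L V z = blaschke z *\<^sub>C \<Psi> z"
proof -
  have "\<Phi> z o\<^sub>L V z = blaschke z *\<^sub>C ((\<Phi> z o\<^sub>L op_inverse (\<Phi> z)) o\<^sub>L \<Psi> z)"
    using assms by (simp add: model_V_def blinfun_compose_scaleC_right blinfun_compose_assoc)
  then show ?thesis by (simp add: op_inverse_right[OF assms(2)])
qed

text \<open>Multiplying out cancels the inverses in \<open>V\<close> and leaves the kernel identity,
  with no division by the denominator. It yields the kernel formula and, on the diagonal, the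
  contraction estimate.\<close>

lemma Phi_defect:
  assumes l: "Im l \<noteq> 0" "l \<noteq> - \<i>" "op_invertible (\<Phi> l)"
    and z: "Im z \<noteq> 0" "z \<noteq> - \<i>" "op_invertible (\<Phi> z)"
  shows "\<Phi> z o\<^sub>L ((id_blinfun - (V z o\<^sub>L op_adj (V l))) o\<^sub>L op_adj (\<Phi> l)) =
    (1 - cnj (blaschke l) * blaschke z) *\<^sub>C K l z"
proof -
  have "op_adj (V l) o\<^sub>L op_adj (\<Phi> l) = cnj (blaschke l) *\<^sub>C op_adj (\<Psi> l)"
    using l by (simp add: op_adj_compose[symmetric] Phi_V op_adj_scaleC)
  moreover have "\<Phi> z o\<^sub>L ((id_blinfun - (V z o\<^sub>L op_adj (V l))) o\<^sub>L op_adj (\<Phi> l)) =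
      (\<Phi> z o\<^sub>L op_adj (\<Phi> l)) - ((\<Phi> z o\<^sub>L V z) o\<^sub>L (op_adj (V l) o\<^sub>L op_adj (\<Phi> l)))"
    by (simp add: blinfun_comp.diff_left blinfun_comp.diff_right blinfun_compose_assoc)
  ultimately show ?thesis
    unfolding kernel_identity[OF l(1,2) z(1,2)]
    using l z by (simp add: Phi_V blinfun_compose_scaleC_left
        blinfun_compose_scaleC_right scaleC_scaleC mult.commute)
qed

lemma kernel_formula_regular:
  assumes "(l, z) \<in> regular_pairs \<Gamma>"
  shows "kernel_formula \<Gamma> l z = K l z"
proof -
  have l: "Im l \<noteq> 0" "l \<noteq> - \<i>" "op_invertible (\<Phi> l)"
    and z: "Im z \<noteq> 0" "z \<noteq> - \<i>" "op_invertible (\<Phi> z)"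
    and d: "1 - cnj (blaschke l) * blaschke z \<noteq> 0"
    using assms by (auto simp: regular_pairs_def)
  have "kernel_formula \<Gamma> l z = (1 / (1 - cnj (blaschke l) * blaschke z)) *\<^sub>C
      (\<Phi> z o\<^sub>L ((id_blinfun - (V z o\<^sub>L op_adj (V l))) o\<^sub>L op_adj (\<Phi> l)))"
    using z by (simp add: kernel_formula_def blinfun_compose_assoc blinfun_compose_scaleC_left
        blinfun_compose_scaleC_right)
  then show ?thesis
    unfolding Phi_defect[OF l z] using d by (simp add: scaleC_scaleC)
qed

text \<open>At regular pairs the formula agrees with \<open>K\<close>, so the limit is an instance
  of the joint continuity of \<open>K\<close>. Where regular pairs do not accumulate, the filter is
  trivial.\<close>

lemma kernel_formula_tendsto:
  assumes "Im l \<noteq> 0" "Im z \<noteq> 0"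
  shows "((\<lambda>(\<mu>, w). kernel_formula \<Gamma> \<mu> w) \<longlongrightarrow> K l z) (at (l, z) within regular_pairs \<Gamma>)"
proof -
  have "((\<lambda>(\<mu>, w). K \<mu> w) \<longlongrightarrow> K l z) (at (l, z) within nonreal \<times> nonreal)"
    using K_continuous assms unfolding continuous_on_def by force
  then have "((\<lambda>(\<mu>, w). K \<mu> w) \<longlongrightarrow> K l z) (at (l, z) within regular_pairs \<Gamma>)"
    by (rule tendsto_within_subset) (auto simp: regular_pairs_def)
  then show ?thesis
  proof (rule Lim_transform_eventually)
    show "\<forall>\<^sub>F p in at (l, z) within regular_pairs \<Gamma>.
        (case p of (\<mu>, w) \<Rightarrow> K \<mu> w) = (case p of (\<mu>, w) \<Rightarrow> kernel_formula \<Gamma> \<mu> w)"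
      unfolding eventually_at_filter
      by (intro always_eventually) (auto simp: kernel_formula_regular)
  qed
qed

section \<open>Contractivity and meromorphy of \<open>V\<close>\<close>

lemma Phi_invertible:
  assumes "Im z > 0"
  shows "op_invertible (\<Phi> z)"
  unfolding model_Phi_def model_kernel_def
  using assms by (intro op_invertible_compose op_invertible_op_inverse K_invertible sqrt_plus(3)) simp

text \<open>Flanking \<open>id_blinfun - (V z o\<^sub>L op_adj (V z))\<close> with
  \<open>\<Phi> z\<close> and its adjoint gives a positive multiple of \<open>K z z\<close>, whose
  quadratic form has the lower bound \<open>c\<close>. A uniform \<open>\<delta>\<close> is required
  because the operator norm is a supremum that need not be attained.\<close>

lemma norm_V_less_1:
  assumes z: "Im z > 0"
  shows "norm (V z) < 1"
proof -
  have z': "Im z \<noteq> 0" "z \<noteq> - \<i>" using z by auto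
  have inv: "op_invertible (\<Phi> z)" by (rule Phi_invertible[OF z])
  obtain c where c: "0 < c" "\<And>x. c * (norm x)\<^sup>2 \<le> (norm (blinfun_apply (\<Gamma> z) x))\<^sup>2"
    using op_invertible_gram_bound[OF K_invertible[of z z]] z by blast
  define \<beta> where "\<beta> = 1 - (cmod (blaschke z))\<^sup>2"
  have \<beta>: "0 < \<beta>" using norm_blaschke_less_1[OF z] by (simp add: \<beta>_def power_less_one_iff)
  define m where "m = norm (op_adj (\<Phi> z)) + 1"
  have m: "0 < m" by (simp add: m_def add_nonneg_pos)
  define \<delta> where "\<delta> = \<beta> * c / m\<^sup>2"
  have \<delta>: "0 < \<delta>" using \<beta> c m by (simp add: \<delta>_def)
  have bound: "(norm (blinfun_apply (op_adj (V z)) y))\<^sup>2 \<le> (1 - \<delta>) * (norm y)\<^sup>2" for y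
  proof -
    \<comment> \<open>The preimage of \<open>y\<close> under \<open>op_adj (\<Phi> z)\<close>: the
      quadratic form of the defect at \<open>y\<close> becomes a multiple of that of
      \<open>K z z\<close> at \<open>x\<close>.\<close>
    define x where "x = blinfun_apply (op_inverse (op_adj (\<Phi> z))) y"
    have y: "blinfun_apply (op_adj (\<Phi> z)) x = y"
      unfolding x_def using op_inverse_adj(2)[OF Phi_ops[OF z'(1)] inv] by (rule op_inverse_apply_right)
    have "norm y \<le> norm (op_adj (\<Phi> z)) * norm x" unfolding y[symmetric] by (rule norm_blinfun)
    also have "\<dots> \<le> m * norm x" by (intro mult_right_mono) (auto simp: m_def)
    finally have "(norm y)\<^sup>2 \<le> (m * norm x)\<^sup>2" by (rule power_mono) simp
    then have x_ge: "(norm y)\<^sup>2 / m\<^sup>2 \<le> (norm x)\<^sup>2" using m by (simp add: power_mult_distrib divide_le_eq mult.commute)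
    have "cinner (blinfun_apply (id_blinfun - (V z o\<^sub>L op_adj (V z))) y) y =
        cinner (blinfun_apply (\<Phi> z o\<^sub>L ((id_blinfun - (V z o\<^sub>L op_adj (V z))) o\<^sub>L op_adj (\<Phi> z))) x) x"
      using z' by (simp add: y cinner_op_adj_right[symmetric])
    also have "\<dots> = (1 - cnj (blaschke z) * blaschke z) * cinner (blinfun_apply (K z z) x) x"
      unfolding Phi_defect[OF z' inv z' inv] by (simp add: scaleC_blinfun.rep_eq cinner_scaleC_left)
    also have "\<dots> = of_real (\<beta> * (norm (blinfun_apply (\<Gamma> z) x))\<^sup>2)"
      unfolding model_kernel_def cinner_gram[OF Gamma_ops[OF z'(1)]]
      by (simp add: \<beta>_def complex_norm_square mult.commute del: of_real_power)
    finally have "cinner (blinfun_apply (id_blinfun - (V z o\<^sub>L op_adj (V z))) y) y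
        = of_real (\<beta> * (norm (blinfun_apply (\<Gamma> z) x))\<^sup>2)" .
    moreover have "cinner (blinfun_apply (id_blinfun - (V z o\<^sub>L op_adj (V z))) y) y
        = of_real ((norm y)\<^sup>2 - (norm (blinfun_apply (op_adj (V z)) y))\<^sup>2)"
      using z' by (simp add: blinfun.diff_left cinner_diff_left cinner_self cinner_op_adj_right[symmetric]
          del: of_real_power)
    ultimately have "(norm y)\<^sup>2 - (norm (blinfun_apply (op_adj (V z)) y))\<^sup>2
        = \<beta> * (norm (blinfun_apply (\<Gamma> z) x))\<^sup>2"
      by (simp only: of_real_eq_iff)
    moreover have "\<delta> * (norm y)\<^sup>2 \<le> \<beta> * (norm (blinfun_apply (\<Gamma> z) x))\<^sup>2"
    proof -
      have "\<delta> * (norm y)\<^sup>2 = \<beta> * (c * ((norm y)\<^sup>2 / m\<^sup>2))" by (simp add: \<delta>_def)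
      also have "\<dots> \<le> \<beta> * (c * (norm x)\<^sup>2)" using \<beta> c x_ge by (intro mult_left_mono) auto
      also have "\<dots> \<le> \<beta> * (norm (blinfun_apply (\<Gamma> z) x))\<^sup>2" using \<beta> c by (intro mult_left_mono) auto
      finally show ?thesis .
    qed
    ultimately show ?thesis by (simp add: algebra_simps)
  qed
  \<comment> \<open>The maximum matters on the zero space, where nothing prevents
    \<open>\<delta>\<close> from exceeding 1.\<close>
  define \<rho> where "\<rho> = sqrt (max 0 (1 - \<delta>))"
  have "norm (op_adj (V z)) \<le> \<rho>"
  proof (rule norm_blinfun_bound)
    fix y :: 'k
    have "(1 - \<delta>) * (norm y)\<^sup>2 \<le> max 0 (1 - \<delta>) * (norm y)\<^sup>2" by (intro mult_right_mono) auto
    also have "\<dots> = (\<rho> * norm y)\<^sup>2" by (simp add: \<rho>_def power_mult_distrib)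
    finally have "(norm (blinfun_apply (op_adj (V z)) y))\<^sup>2 \<le> (\<rho> * norm y)\<^sup>2" using bound[of y] by linarith
    then show "norm (blinfun_apply (op_adj (V z)) y) \<le> \<rho> * norm y"
      by (rule power2_le_imp_le) (simp add: \<rho>_def)
  qed (simp add: \<rho>_def)
  also have "\<rho> < 1" using \<delta> by (simp add: \<rho>_def max_def)
  finally show ?thesis using z' by (simp add: norm_op_adj)
qed

lemma V_holomorphic: "vec_holomorphic_on V {z \<in> nonreal - {- \<i>}. op_invertible (\<Phi> z)}"
  unfolding model_V_def[abs_def]
  by (intro vec_holomorphic_on_scaleC holomorphic_on_blaschke vec_holomorphic_on_compose
      vec_holomorphic_on_op_inverse vec_holomorphic_on_subset[OF Phi_holomorphic]
      vec_holomorphic_on_subset[OF Psi_holomorphic]) auto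

lemma Phi_inverse_meromorphic_upper: "vec_meromorphic_on (\<lambda>z. op_inverse (\<Phi> z)) upper_half"
proof (rule vec_holomorphic_on_imp_meromorphic_on)
  show "vec_holomorphic_on (\<lambda>z. op_inverse (\<Phi> z)) upper_half"
    by (intro vec_holomorphic_on_op_inverse vec_holomorphic_on_subset[OF Phi_holomorphic])
      (auto simp: Phi_invertible)
  show "open upper_half" by (intro open_Collect_less continuous_intros)
qed

lemma Phi_inverse_meromorphic_lower:
  assumes "has_hilbert_dim (UNIV :: 'k set) n" "n \<noteq> \<infinity>"
  shows "vec_meromorphic_on (\<lambda>z. op_inverse (\<Phi> z)) lower_half"
proof -
  obtain N where N: "n = enat N" using assms(2) by auto
  obtain e :: "nat \<Rightarrow> 'k" where "finite_onb e N"
    using has_hilbert_dim_finite_onb assms(1) unfolding N by blast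
  then interpret finite_onb e N .
  show ?thesis
  proof (rule vec_meromorphic_on_op_inverse)
    show "vec_holomorphic_on \<Phi> lower_half"
      by (rule vec_holomorphic_on_subset[OF Phi_holomorphic]) auto
    show "open lower_half" by (intro open_Collect_less continuous_intros)
    \<comment> \<open>Connectedness is the reason to treat a single half plane instead of
      \<open>nonreal\<close>.\<close>
    show "connected lower_half" by (intro convex_connected convex_halfspace_Im_lt)
  qed simp
qed

lemma V_meromorphic:
  assumes "vec_meromorphic_on (\<lambda>z. op_inverse (\<Phi> z)) lower_half"
  shows "vec_meromorphic_on V nonreal"
proof -
  \<comment> \<open>Meromorphy is a condition at each point, so the two half planes can be treated
    separately and joined.\<close>
  have "nonreal = upper_half \<union> lower_half" by auto
  then have inv: "vec_meromorphic_on (\<lambda>z. op_inverse (\<Phi> z)) nonreal"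
    using assms Phi_inverse_meromorphic_upper by (simp only: vec_meromorphic_on_Un)
  have Psi: "vec_meromorphic_on \<Psi> nonreal"
    by (rule vec_holomorphic_on_imp_meromorphic_on[OF Psi_holomorphic open_nonreal])
  show ?thesis
    unfolding model_V_def[abs_def]
    by (intro vec_meromorphic_on_scaleC vec_meromorphic_on_blaschke vec_meromorphic_on_compose inv Psi open_nonreal) simp
qed

end

theorem theorem4p1:
  fixes n :: enat
    and D :: "'h::complex_hilbert set" and T :: "'h \<Rightarrow> 'h"
    and \<Gamma> :: "complex \<Rightarrow> 'k::complex_hilbert \<Rightarrow>\<^sub>L 'h"
  assumes H_separable: "separable_space (euclidean :: 'h topology)"
    and K_separable: "separable_space (euclidean :: 'k topology)"
    and K_dim: "has_hilbert_dim (UNIV :: 'k set) n"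
    and T_class: "simple_symmetric n D T"
    and model: "is_model D T \<Gamma>"
  shows
    \<comment> \<open>The first three conjuncts are the kernel formula: at regular pairs; at all pairs, as the limit
        from the regular ones; and with the poles cancelled. The last four are about \<open>V\<close>; for infinite
        \<open>n\<close> the inverse of \<open>\<Phi>\<close> need not be meromorphic on the lower half plane.\<close>
   "(\<forall>(l, z)\<in>regular_pairs \<Gamma>. model_kernel \<Gamma> l z = kernel_formula \<Gamma> l z) \<and>
    (\<forall>l\<in>nonreal. \<forall>z\<in>nonreal.
       ((\<lambda>(\<mu>, w). kernel_formula \<Gamma> \<mu> w) \<longlongrightarrow> model_kernel \<Gamma> l z)
         (at (l, z) within regular_pairs \<Gamma>)) \<and>
    (\<forall>l\<in>nonreal - {- \<i>}. \<forall>z\<in>nonreal - {- \<i>}.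
       (1 - cnj (blaschke l) * blaschke z) *\<^sub>C model_kernel \<Gamma> l z =
       (model_Phi \<Gamma> z o\<^sub>L op_adj (model_Phi \<Gamma> l)) -
       (cnj (blaschke l) * blaschke z) *\<^sub>C (model_Psi \<Gamma> z o\<^sub>L op_adj (model_Psi \<Gamma> l))) \<and>
    (\<forall>z\<in>nonreal. model_Phi \<Gamma> z \<in> bounded_ops) \<and>
    vec_meromorphic_on (model_Phi \<Gamma>) nonreal \<and>
    vec_holomorphic_on (model_Phi \<Gamma>) upper_half \<and>
    (\<forall>z\<in>nonreal. model_Psi \<Gamma> z \<in> bounded_ops) \<and>
    vec_meromorphic_on (model_Psi \<Gamma>) nonreal \<and>
    vec_holomorphic_on (model_Psi \<Gamma>) lower_half \<and>
    (\<forall>z\<in>nonreal. model_V \<Gamma> z \<in> bounded_ops) \<and>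
    (n \<noteq> \<infinity> \<or> vec_meromorphic_on (\<lambda>z. op_inverse (model_Phi \<Gamma> z)) lower_half \<longrightarrow>
       vec_meromorphic_on (model_V \<Gamma>) nonreal) \<and>
    vec_holomorphic_on (model_V \<Gamma>) {z \<in> nonreal - {- \<i>}. op_invertible (model_Phi \<Gamma> z)} \<and>
    (\<forall>z\<in>upper_half. op_invertible (model_Phi \<Gamma> z) \<and> norm (model_V \<Gamma> z) < 1)"
proof -
  interpret symmetric_model D T \<Gamma>
    using T_class model by unfold_locales (auto simp: simple_symmetric_def)
  show ?thesis
  proof (intro conjI)
    show "\<forall>(l, z)\<in>regular_pairs \<Gamma>. model_kernel \<Gamma> l z = kernel_formula \<Gamma> l z"
      by (auto simp: kernel_formula_regular)
    show "\<forall>l\<in>nonreal. \<forall>z\<in>nonreal. ((\<lambda>(\<mu>, w). kernel_formula \<Gamma> \<mu> w) \<longlongrightarrow> model_kernel \<Gamma> l z)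
        (at (l, z) within regular_pairs \<Gamma>)"
      using kernel_formula_tendsto by blast
    show "\<forall>l\<in>nonreal - {- \<i>}. \<forall>z\<in>nonreal - {- \<i>}.
       (1 - cnj (blaschke l) * blaschke z) *\<^sub>C model_kernel \<Gamma> l z =
       (model_Phi \<Gamma> z o\<^sub>L op_adj (model_Phi \<Gamma> l)) -
       (cnj (blaschke l) * blaschke z) *\<^sub>C (model_Psi \<Gamma> z o\<^sub>L op_adj (model_Psi \<Gamma> l))"
      using kernel_identity by blast
    show "vec_meromorphic_on (model_Phi \<Gamma>) nonreal" "vec_meromorphic_on (model_Psi \<Gamma>) nonreal"
      using vec_holomorphic_on_imp_meromorphic_on open_nonreal Phi_holomorphic Psi_holomorphic by blast+
    show "vec_holomorphic_on (model_Phi \<Gamma>) upper_half"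
      by (rule vec_holomorphic_on_subset[OF Phi_holomorphic]) auto
    show "vec_holomorphic_on (model_Psi \<Gamma>) lower_half"
      by (rule vec_holomorphic_on_subset[OF Psi_holomorphic]) auto
    \<comment> \<open>For finite \<open>n\<close> the determinant argument makes the inverse
      meromorphic; otherwise this is the second alternative itself.\<close>
    show "n \<noteq> \<infinity> \<or> vec_meromorphic_on (\<lambda>z. op_inverse (model_Phi \<Gamma> z)) lower_half \<longrightarrow>
        vec_meromorphic_on (model_V \<Gamma>) nonreal"
      using V_meromorphic Phi_inverse_meromorphic_lower[OF K_dim] by blast
    show "vec_holomorphic_on (model_V \<Gamma>) {z \<in> nonreal - {- \<i>}. op_invertible (model_Phi \<Gamma> z)}"
      by (rule V_holomorphic)
  qed (auto simp: Phi_invertible norm_V_less_1)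
qed

end
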